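(* Let $\bar{\mathbb{F}}\in\{\mathbb{A},\ldots,\mathbb{Z}\}$ be one of the $26$ families listed in the context, with fixed admissible parameters, and let $B_{\bar{\mathbb{F}}}$ be the corresponding algebra. Let \[ L=\lambda_1x_1+\lambda_2x_2+\mu_1y_1+\mu_2y_2\in B_{\bar{\mathbb{F}}},\qquad \lambda_1,\lambda_2,\mu_1,\mu_2\in\Bbbk . \] For every integer $N\ge0$ there exist unique coefficients $E_{\bar{\mathbb{F}},N}^{L}(A,B,C,D)\in\Bbbk$ ($A,B,C,D\ge0$ integers; only finitely many nonzero) such that \[ L^N=\sum_{A,B,C,D\ge0}E_{\bar{\mathbb{F}},N}^{L}(A,B,C,D)\,x_1^Ax_2^By_1^Cy_2^D . \] They are determined by $E_{\bar{\mathbb{F}},0}^{L}(0,0,0,0)=1$, $E_{\bar{\mathbb{F}},0}^{L}(A,B,C,D)=0$ if $(A,B,C,D)\neq(0,0,0,0)$, and by the recurrence \begin{align*} E_{\bar{\mathbb{F}},N+1}^{L}(A,B,C,D) &=\lambda_1\sum_{A',B',C',D'\ge0}E_{\bar{\mathbb{F}},N}^{L}(A',B',C',D')\,\mathfrak{m}_{\bar{\mathbb{F}}}\begin{bmatrix}A',B';C',D'\\ 1,0;0,0\\ A,B;C,D\end{bmatrix}\\ &\quad+\lambda_2\sum_{A',B',C',D'\ge0}E_{\bar{\mathbb{F}},N}^{L}(A',B',C',D')\,\mathfrak{m}_{\bar{\mathbb{F}}}\begin{bmatrix}A',B';C',D'\\ 0,1;0,0\\ A,B;C,D\end{bmatrix}\\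 &\quad+\mu_1\sum_{A',B',C',D'\ge0}E_{\bar{\mathbb{F}},N}^{L}(A',B',C',D')\,\mathfrak{m}_{\bar{\mathbb{F}}}\begin{bmatrix}A',B';C',D'\\ 0,0;1,0\\ A,B;C,D\end{bmatrix}\\ &\quad+\mu_2\sum_{A',B',C',D'\ge0}E_{\bar{\mathbb{F}},N}^{L}(A',B',C',D')\,\mathfrak{m}_{\bar{\mathbb{F}}}\begin{bmatrix}A',B';C',D'\\ 0,0;0,1\\ A,B;C,D\end{bmatrix}. \end{align*}
   Context: **Ground field.** $\Bbbk$ is an algebraically closed field of characteristic zero; algebras are associative and unital. $\delta_{u,v}$ (with two subscripts) is the Kronecker delta; $\delta$ without subscripts is an integer index. **The families.** Each family $\bar{\mathbb{F}}$ is given by scalars $(q_{\bar{\mathbb{F}}},r_{\bar{\mathbb{F}}})$, $(p_{\bar{\mathbb{F}}},s_{\bar{\mathbb{F}}})$ and finite sets $\mathscr{K}_{i,s}^{\bar{\mathbb{F}}}\subseteq\Bbbk\times\{1,2\}\times\{1,2\}$, $i,s\in\{1,2\}$, of triples $(\lambda;t,\ell)$. The algebra $B_{\bar{\mathbb{F}}}$ is generated by $x_1,x_2,y_1,y_2$ with the six defining relations \[ x_2x_1=q_{\bar{\mathbb{F}}}x_1x_2+r_{\bar{\mathbb{F}}}x_1^2,\quad y_2y_1=p_{\bar{\mathbb{F}}}y_1y_2+s_{\bar{\mathbb{F}}}y_1^2,\quad y_ix_s=\sum_{(\lambda;t,\ell)\in\mathscr{K}_{i,s}^{\bar{\mathbb{F}}}}\lambda\,x_ty_\ell\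 \ (i,s\in\{1,2\}). \] Values of $(q_{\bar{\mathbb{F}}},r_{\bar{\mathbb{F}}})$; $(p_{\bar{\mathbb{F}}},s_{\bar{\mathbb{F}}})$: $\mathbb{A}$: $(1,0);(1,1)$. $\mathbb{B},\mathbb{C}$: $(p,0);(p,0)$. $\mathbb{D},\mathbb{E},\mathbb{F}$: $(-1,0);(p,0)$. $\mathbb{G}$: $(1,0);(p,0)$. $\mathbb{H}$: $(1,1);(-1,0)$. $\mathbb{I},\mathbb{J},\mathbb{K},\mathbb{L}$: $(q,0);(-1,0)$. $\mathbb{M},\mathbb{N},\mathbb{O},\mathbb{P},\mathbb{Q},\mathbb{R},\mathbb{S},\mathbb{T},\mathbb{U}$: $(-1,0);(-1,0)$. $\mathbb{V},\mathbb{W},\mathbb{X},\mathbb{Y}$: $(1,0);(-1,0)$. $\mathbb{Z}$: $(-1,0);(1,0)$. Sets $\mathscr{K}_{1,1}\mid\mathscr{K}_{1,2}\mid\mathscr{K}_{2,1}\mid\mathscr{K}_{2,2}$ in this order: - $\mathbb{A}$: $(1;1,1)\mid(1;2,1),(1;1,2)\mid(1;1,2)\mid(-2;2,1),(-1;1,2),(1;2,2)$ - $\mathbb{B}$: $(1;2,2)\mid(1;1,2)\mid(-1;2,1)\mid(1;1,1)$ - $\mathbb{C}$: $(-1;1,1),(p^2;2,1),(1;1,2),(-p;2,2)\mid(-p;1,1),(1;2,1),(1;1,2),(-p;2,2)\mid(-p;1,1),(-2p^2;2,1),(p;1,2),(-p;2,2)\mid(-p;1,1),(p^2;2,1),(1;1,2),(-1;2,2)$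 - $\mathbb{D}$: $(-p;1,1)\mid(-p^2;2,1),(1;1,2)\mid(p;1,2)\mid(1;1,1),(1;2,2)$ - $\mathbb{E}$: $(1;1,2),(1;2,2)\mid(1;1,2),(-1;2,2)\mid(-1;1,1),(1;2,1)\mid(1;1,1),(1;2,1)$ - $\mathbb{F}$: $(-1;1,1),(-p;2,1),(1;1,2),(-1;2,2)\mid(-p;1,1),(1;2,1),(1;1,2),(1;2,2)\mid(-p;1,1),(p;2,1),(p;1,2),(1;2,2)\mid(-p;1,1),(-p;2,1),(1;1,2),(-p;2,2)$ - $\mathbb{G}$: $(p;1,1)\mid(p;1,1),(p^2;2,1),(1;1,2)\mid(p;1,2)\mid(f;1,1),(-1;1,2),(1;2,2)$ - $\mathbb{H}$: $(1;1,2)\mid(f;1,2),(1;2,2)\mid(1;1,1)\mid(f;1,1),(1;2,1)$ - $\mathbb{I}$: $(-q;1,1),(-q;2,1),(1;1,2),(-q;2,2)\mid(1;1,1),(1;2,1),(1;1,2),(-q;2,2)\mid(1;1,1),(q;2,1),(q;1,2),(-q;2,2)\mid(-1;1,1),(-q;2,1),(1;1,2),(-1;2,2)$ - $\mathbb{J}$: $(1;2,1),(1;2,2)\mid(-1;1,1),(1;1,2)\mid(1;2,1),(-1;2,2)\mid(1;1,1),(1;1,2)$ - $\mathbb{K}$: $(1;1,1)\mid(1;2,2)\mid(1;1,2)\mid(f;2,1)$ - $\mathbb{L}$: $(f;1,2)\mid(1;2,2)\mid(f;1,1)\mid(1;2,1)$ - $\mathbb{M}$: $(1;2,1),(1;1,2)\mid(f;1,1),(-1;2,2)\mid(1;1,1),(-1;2,2)\mid(-1;2,1),(-f;1,2)$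 - $\mathbb{N}$: $(-g;2,1),(f;2,2)\mid(g;1,1),(f;1,2)\mid(f;2,1),(-g;2,2)\mid(f;1,1),(g;1,2)$ - $\mathbb{O}$: $(1;1,1),(f;2,2)\mid(-1;2,1),(1;1,2)\mid(f;2,1),(-1;1,2)\mid(1;1,1),(1;2,2)$ - $\mathbb{P}$: $(1;1,2),(f;2,2)\mid(1;1,2),(1;2,2)\mid(1;1,1),(-f;2,1)\mid(-1;1,1),(1;2,1)$ - $\mathbb{Q}$: $(1;1,2)\mid(1;1,1),(1;2,1),(1;1,2)\mid(-1;1,1)\mid(1;1,1),(-1;1,2),(1;2,2)$ - $\mathbb{R}$: $(1;1,1),(1;2,1),(1;1,2)\mid(1;1,2)\mid(1;2,1)\mid(-1;2,1),(-1;1,2),(1;2,2)$ - $\mathbb{S}$: $(-1;1,1),(1;2,1),(1;1,2),(1;2,2)\mid(1;1,1),(-1;2,1),(1;1,2),(1;2,2)\mid(1;1,1),(1;2,1),(-1;1,2),(1;2,2)\mid(1;1,1),(1;2,1),(1;1,2),(-1;2,2)$ - $\mathbb{T}$: $(-1;1,1),(1;2,1),(1;1,2),(1;2,2)\mid(1;1,1),(-1;2,1),(1;1,2),(1;2,2)\mid(1;1,1),(1;2,1),(1;1,2),(-1;2,2)\mid(1;1,1),(1;2,1),(-1;1,2),(1;2,2)$ - $\mathbb{U}$: $(-1;1,1),(1;2,1),(1;1,2),(1;2,2)\mid(1;1,1),(1;2,1),(1;1,2),(-1;2,2)\mid(1;1,1),(1;2,1),(-1;1,2),(1;2,2)\mid(1;1,1),(-1;2,1),(1;1,2),(1;2,2)$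 - $\mathbb{V}$: $(1;2,1),(1;1,2)\mid(1;2,1)\mid(-1;1,1),(1;2,1)\mid(1;2,2)$ - $\mathbb{W}$: $(f;2,1),(1;1,2)\mid(1;1,1),(-1;2,2)\mid(1;1,1),(f;2,2)\mid(-1;2,1),(1;1,2)$ - $\mathbb{X}$: $(1;1,2)\mid(1;1,2),(1;2,2)\mid(1;1,1)\mid(1;1,1),(1;2,1)$ - $\mathbb{Y}$: $(1;1,1)\mid(f;1,1),(-1;2,1),(1;1,2)\mid(1;1,2)\mid(1;1,1),(f;1,2),(-1;2,2)$ - $\mathbb{Z}$: $(1;1,1),(1;2,2)\mid(1;2,1),(1;1,2)\mid(f;2,1),(-1;1,2)\mid(f;1,1),(-1;2,2)$ **Admissible parameters.** The parameters $p,q,f,g\in\Bbbk$ occurring in a family are assumed to be such that $q_{\bar{\mathbb{F}}},p_{\bar{\mathbb{F}}}\neq0$ and $B_{\bar{\mathbb{F}}}$ is a trimmed double extension of $R=\Bbbk\{x_1,x_2\}/\langle x_2x_1-q_{\bar{\mathbb{F}}}x_1x_2-r_{\bar{\mathbb{F}}}x_1^2\rangle$ (via $x_s\mapsto x_s$). Here a trimmed double extension of $R$ is an algebra $B$ containing $R$ as a subalgebra, generated by $R$ and elements $y_1,y_2$, such that: $y_2y_1=p_{12}y_1y_2+p_{11}y_1^2$ with $p_{12}\in\Bbbk^\times,p_{11}\in\Bbbk$; $y_ir=\sum_{j=1}^2\sigma_{ij}(r)y_j$ for all $r\in R$, for some maps $\sigma_{ij}:R\to R$; $B$ is a free left $R$-module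 with basis $\{y_1^iy_2^j\}_{i,j\ge0}$ and a free right $R$-module with basis $\{y_2^iy_1^j\}_{i,j\ge0}$; and $y_1R+y_2R+R=Ry_1+Ry_2+R$. **Normal form.** Consequently the monomials $x_1^ax_2^by_1^cy_2^d$ ($a,b,c,d\ge0$) form a $\Bbbk$-basis of $B_{\bar{\mathbb{F}}}$, and $\mathrm{NF}_{\bar{\mathbb{F}}}(\omega)$ denotes the unique (finite) expansion of the element represented by $\omega$ in this basis. **Coefficients.** The scalars $\Theta_{\bar{\mathbb{F}}}(a,b;c,d;\alpha,\beta;\gamma,\delta)$ are the coefficients in $\mathrm{NF}_{\bar{\mathbb{F}}}(y_1^cy_2^dx_1^ax_2^b)=\sum_{\alpha,\beta,\gamma,\delta\ge0}\Theta_{\bar{\mathbb{F}}}(a,b;c,d;\alpha,\beta;\gamma,\delta)x_1^\alpha x_2^\beta y_1^\gamma y_2^\delta$. For $q\in\Bbbk^\times$: $[n]_q:=1+q+\cdots+q^{n-1}$, $[0]_q:=0$; $\begin{bmatrix}0\\0\end{bmatrix}_q=1$, $\begin{bmatrix}n\\k\end{bmatrix}_q=0$ if $k<0$ or $k>n$, $\begin{bmatrix}n+1\\k\end{bmatrix}_q=\begin{bmatrix}n\\k-1\end{bmatrix}_q+q^k\begin{bmatrix}n\\k\end{bmatrix}_q$; $[m]_q^{\overline{k}}:=\prod_{j=0}^{k-1}[m+j]_q$; $\Lambda_{q,r}(n,m;k):=r^kq^{m(n-k)}\begin{bmatrix}n\\k\end{bmatrix}_q[m]_q^{\overline{k}}$,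 equal to $0$ if $k>n$ (with $0^0=1$). The product constants are \[ \mathfrak{m}_{\bar{\mathbb{F}}}\begin{bmatrix}a,b;c,d\\ a',b';c',d'\\ A,B;C,D\end{bmatrix} :=\sum_{\alpha,\beta,\gamma,\delta\ge0}\ \sum_{r,s\ge0}\Theta_{\bar{\mathbb{F}}}(a',b';c,d;\alpha,\beta;\gamma,\delta)\,\Lambda_{q_{\bar{\mathbb{F}}},r_{\bar{\mathbb{F}}}}(b,\alpha;r)\,\Lambda_{p_{\bar{\mathbb{F}}},s_{\bar{\mathbb{F}}}}(\delta,c';s)\,\delta_{A,a+\alpha+r}\,\delta_{B,b-r+\beta}\,\delta_{C,\gamma+c'+s}\,\delta_{D,\delta-s+d'} . \] *)

theory Defs
  imports
    "HOL-Algebra.Algebra"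
    "HOL-Algebra.Algebraic_Closure_Type"
    "HOL-Library.Poly_Mapping"
begin

section \<open>Algebras given by generators and relations\<close>

text \<open>
  Words over \<open>'g\<close> are wrapped in a type of their own so that, as an additive monoid under
  concatenation, they can index \<^type>\<open>poly_mapping\<close>. The type \<open>'g word \<Rightarrow>\<^sub>0 'k\<close> with its convolution
  product is then the free associative unital \<open>'k\<close>-algebra on \<open>'g\<close>.
\<close>

datatype 'g word = Word (letters: "'g list")

instantiation word :: (type) monoid_add
begin

definition zero_word :: "'a word" where
  "zero_word = Word []"

definition plus_word :: "'a word \<Rightarrow> 'a word \<Rightarrow> 'a word" where
  "plus_word u v = Word (letters u @ letters v)"

instance
  by standard (simp_all add: zero_word_def plus_word_def)

end

type_synonym ('g, 'k) free_alg = "'g word \<Rightarrow>\<^sub>0 'k"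

definition gen :: "'g \<Rightarrow> ('g, 'k::field) free_alg" where
  "gen g = Poly_Mapping.single (Word [g]) 1"

definition const :: "'k::field \<Rightarrow> ('g, 'k) free_alg" where
  "const c = Poly_Mapping.single 0 c"

text \<open>\<open>cls S w\<close> is the class of \<open>w\<close> modulo the two-sided ideal generated by \<open>S\<close>.\<close>

definition cls :: "('g, 'k::field) free_alg set \<Rightarrow> ('g, 'k) free_alg \<Rightarrow> ('g, 'k) free_alg set" where
  "cls S w = (Idl\<^bsub>ring_of_type_algebra\<^esub> S) +>\<^bsub>ring_of_type_algebra\<^esub> w"

definition presented_ring :: "('g, 'k::field) free_alg set \<Rightarrow> ('g, 'k) free_alg set ring" where
  "presented_ring S = ring_of_type_algebra Quot (Idl\<^bsub>ring_of_type_algebra\<^esub> S)"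

definition presented_alg ::
  "('g, 'k::field) free_alg set \<Rightarrow> ('k, ('g, 'k) free_alg set) module" where
  "presented_alg S =
     \<lparr>carrier = carrier (presented_ring S), monoid.mult = monoid.mult (presented_ring S),
      one = one (presented_ring S), ring.zero = ring.zero (presented_ring S),
      add = add (presented_ring S),
      module.smult = (\<lambda>c u. cls S (const c) \<otimes>\<^bsub>presented_ring S\<^esub> u)\<rparr>"


section \<open>Trimmed double extensions\<close>

text \<open>The locale \<^locale>\<open>algebra\<close> of HOL-Algebra is about commutative algebras.\<close>

definition assoc_algebra :: "('k::field, 'b) module \<Rightarrow> bool" where
  "assoc_algebra A \<longleftrightarrow>
     ring A \<and> module (ring_of_type_algebra :: 'k ring) A \<and>
     (\<forall>c. \<forall>x\<in>carrier A. \<forall>y\<in>carrier A.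
        (c \<odot>\<^bsub>A\<^esub> x) \<otimes>\<^bsub>A\<^esub> y = c \<odot>\<^bsub>A\<^esub> (x \<otimes>\<^bsub>A\<^esub> y) \<and>
        x \<otimes>\<^bsub>A\<^esub> (c \<odot>\<^bsub>A\<^esub> y) = c \<odot>\<^bsub>A\<^esub> (x \<otimes>\<^bsub>A\<^esub> y))"

definition alg_hom :: "('k::field, 'r) module \<Rightarrow> ('k, 'b) module \<Rightarrow> ('r \<Rightarrow> 'b) set" where
  "alg_hom R B = {\<iota> \<in> ring_hom R B. \<forall>c. \<forall>x\<in>carrier R. \<iota> (c \<odot>\<^bsub>R\<^esub> x) = c \<odot>\<^bsub>B\<^esub> \<iota> x}"

text \<open>
  \<open>B\<close> is regarded as a left or right \<open>R\<close>-module through \<open>\<iota> : R \<rightarrow> B\<close>; a basis is an indexed family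
  \<open>e\<close> such that every element is a finite \<open>R\<close>-linear combination in exactly one way.
\<close>

definition left_free_basis ::
  "('k::field, 'r) module \<Rightarrow> ('k, 'b) module \<Rightarrow> ('r \<Rightarrow> 'b) \<Rightarrow> ('i \<Rightarrow> 'b) \<Rightarrow> bool" where
  "left_free_basis R B \<iota> e \<longleftrightarrow>
     (\<forall>i. e i \<in> carrier B) \<and>
     (\<forall>b\<in>carrier B. \<exists>!c. (\<forall>i. c i \<in> carrier R) \<and> finite {i. c i \<noteq> \<zero>\<^bsub>R\<^esub>} \<and>
        b = (\<Oplus>\<^bsub>B\<^esub>i\<in>{i. c i \<noteq> \<zero>\<^bsub>R\<^esub>}. \<iota> (c i) \<otimes>\<^bsub>B\<^esub> e i))"

definition right_free_basis ::
  "('k::field, 'r) module \<Rightarrow> ('k, 'b) module \<Rightarrow> ('r \<Rightarrow> 'b) \<Rightarrow> ('i \<Rightarrow> 'b) \<Rightarrow> bool" where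
  "right_free_basis R B \<iota> e \<longleftrightarrow>
     (\<forall>i. e i \<in> carrier B) \<and>
     (\<forall>b\<in>carrier B. \<exists>!c. (\<forall>i. c i \<in> carrier R) \<and> finite {i. c i \<noteq> \<zero>\<^bsub>R\<^esub>} \<and>
        b = (\<Oplus>\<^bsub>B\<^esub>i\<in>{i. c i \<noteq> \<zero>\<^bsub>R\<^esub>}. e i \<otimes>\<^bsub>B\<^esub> \<iota> (c i)))"

datatype idx = i1 | i2

locale trimmed_double_extension =
  fixes R :: "('k::field, 'r) module"
    and B :: "('k, 'b) module"
    and \<iota> :: "'r \<Rightarrow> 'b"
    and y :: "idx \<Rightarrow> 'b"
  assumes algebra_R: "assoc_algebra R"
    and algebra_B: "assoc_algebra B"
    and embedding: "\<iota> \<in> alg_hom R B" "inj_on \<iota> (carrier R)"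
    and y_closed: "y i \<in> carrier B"
    \<comment> \<open>the image of \<open>R\<close> contains the scalars, so the generated subring is the generated subalgebra\<close>
    and generated: "generate_ring B (\<iota> ` carrier R \<union> range y) = carrier B"
    and y_relation: "\<exists>p12 p11. p12 \<noteq> 0 \<and>
      y i2 \<otimes>\<^bsub>B\<^esub> y i1 =
        p12 \<odot>\<^bsub>B\<^esub> (y i1 \<otimes>\<^bsub>B\<^esub> y i2) \<oplus>\<^bsub>B\<^esub> p11 \<odot>\<^bsub>B\<^esub> (y i1 [^]\<^bsub>B\<^esub> (2::nat))"
    and yr_relations: "\<exists>\<sigma> :: idx \<Rightarrow> idx \<Rightarrow> 'r \<Rightarrow> 'r.
      (\<forall>i j. \<sigma> i j \<in> carrier R \<rightarrow> carrier R) \<and>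
      (\<forall>i. \<forall>r\<in>carrier R.
        y i \<otimes>\<^bsub>B\<^esub> \<iota> r = \<iota> (\<sigma> i i1 r) \<otimes>\<^bsub>B\<^esub> y i1 \<oplus>\<^bsub>B\<^esub> \<iota> (\<sigma> i i2 r) \<otimes>\<^bsub>B\<^esub> y i2)"
    and left_basis: "left_free_basis R B \<iota>
      (\<lambda>(i :: nat, j :: nat). y i1 [^]\<^bsub>B\<^esub> i \<otimes>\<^bsub>B\<^esub> y i2 [^]\<^bsub>B\<^esub> j)"
    and right_basis: "right_free_basis R B \<iota>
      (\<lambda>(i :: nat, j :: nat). y i2 [^]\<^bsub>B\<^esub> i \<otimes>\<^bsub>B\<^esub> y i1 [^]\<^bsub>B\<^esub> j)"
    and left_right:
      "{y i1 \<otimes>\<^bsub>B\<^esub> \<iota> r \<oplus>\<^bsub>B\<^esub> y i2 \<otimes>\<^bsub>B\<^esub> \<iota> s \<oplus>\<^bsub>B\<^esub> \<iota> t | r s t.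
          r \<in> carrier R \<and> s \<in> carrier R \<and> t \<in> carrier R} =
       {\<iota> r \<otimes>\<^bsub>B\<^esub> y i1 \<oplus>\<^bsub>B\<^esub> \<iota> s \<otimes>\<^bsub>B\<^esub> y i2 \<oplus>\<^bsub>B\<^esub> \<iota> t | r s t.
          r \<in> carrier R \<and> s \<in> carrier R \<and> t \<in> carrier R}"


section \<open>The 26 families\<close>

text \<open>
  Each constructor carries the parameters occurring in the family, always in the order
  \<open>p\<close>, \<open>q\<close>, \<open>f\<close>, \<open>g\<close> (so \<open>FamG p f\<close>, \<open>FamK q f\<close>, \<open>FamN f g\<close>).
\<close>

datatype 'k family =
    FamA | FamB 'k | FamC 'k | FamD 'k | FamE 'k | FamF 'k
  | FamG 'k 'k | FamH 'k | FamI 'k | FamJ 'k | FamK 'k 'k | FamL 'k 'k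
  | FamM 'k | FamN 'k 'k | FamO 'k | FamP 'k | FamQ | FamR
  | FamS | FamT | FamU | FamV | FamW 'k | FamX
  | FamY 'k | FamZ 'k

text \<open>\<open>x_scalars F\<close> is \<open>(q\<^sub>F, r\<^sub>F)\<close> and \<open>y_scalars F\<close> is \<open>(p\<^sub>F, s\<^sub>F)\<close>.\<close>

primrec x_scalars :: "'k::field family \<Rightarrow> 'k \<times> 'k" where
  "x_scalars FamA = (1, 0)"
| "x_scalars (FamB p) = (p, 0)"
| "x_scalars (FamC p) = (p, 0)"
| "x_scalars (FamD p) = (-1, 0)"
| "x_scalars (FamE p) = (-1, 0)"
| "x_scalars (FamF p) = (-1, 0)"
| "x_scalars (FamG p f) = (1, 0)"
| "x_scalars (FamH f) = (1, 1)"
| "x_scalars (FamI q) = (q, 0)"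
| "x_scalars (FamJ q) = (q, 0)"
| "x_scalars (FamK q f) = (q, 0)"
| "x_scalars (FamL q f) = (q, 0)"
| "x_scalars (FamM f) = (-1, 0)"
| "x_scalars (FamN f g) = (-1, 0)"
| "x_scalars (FamO f) = (-1, 0)"
| "x_scalars (FamP f) = (-1, 0)"
| "x_scalars FamQ = (-1, 0)"
| "x_scalars FamR = (-1, 0)"
| "x_scalars FamS = (-1, 0)"
| "x_scalars FamT = (-1, 0)"
| "x_scalars FamU = (-1, 0)"
| "x_scalars FamV = (1, 0)"
| "x_scalars (FamW f) = (1, 0)"
| "x_scalars FamX = (1, 0)"
| "x_scalars (FamY f) = (1, 0)"
| "x_scalars (FamZ f) = (-1, 0)"

primrec y_scalars :: "'k::field family \<Rightarrow> 'k \<times> 'k" where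
  "y_scalars FamA = (1, 1)"
| "y_scalars (FamB p) = (p, 0)"
| "y_scalars (FamC p) = (p, 0)"
| "y_scalars (FamD p) = (p, 0)"
| "y_scalars (FamE p) = (p, 0)"
| "y_scalars (FamF p) = (p, 0)"
| "y_scalars (FamG p f) = (p, 0)"
| "y_scalars (FamH f) = (-1, 0)"
| "y_scalars (FamI q) = (-1, 0)"
| "y_scalars (FamJ q) = (-1, 0)"
| "y_scalars (FamK q f) = (-1, 0)"
| "y_scalars (FamL q f) = (-1, 0)"
| "y_scalars (FamM f) = (-1, 0)"
| "y_scalars (FamN f g) = (-1, 0)"
| "y_scalars (FamO f) = (-1, 0)"
| "y_scalars (FamP f) = (-1, 0)"
| "y_scalars FamQ = (-1, 0)"
| "y_scalars FamR = (-1, 0)"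
| "y_scalars FamS = (-1, 0)"
| "y_scalars FamT = (-1, 0)"
| "y_scalars FamU = (-1, 0)"
| "y_scalars FamV = (-1, 0)"
| "y_scalars (FamW f) = (-1, 0)"
| "y_scalars FamX = (-1, 0)"
| "y_scalars (FamY f) = (-1, 0)"
| "y_scalars (FamZ f) = (1, 0)"

abbreviation "q_of F \<equiv> fst (x_scalars F)"
abbreviation "r_of F \<equiv> snd (x_scalars F)"
abbreviation "p_of F \<equiv> fst (y_scalars F)"
abbreviation "s_of F \<equiv> snd (y_scalars F)"

text \<open>
  The four sets of triples \<open>(\<lambda>, t, l)\<close>, in the order (1,1), (1,2), (2,1), (2,2). Within a set the pairs
  \<open>(t, l)\<close> are distinct, so no terms are lost by using sets, whatever the parameters.
\<close>

type_synonym 'k triples = "('k \<times> idx \<times> idx) set"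

primrec K_table ::
  "'k::field family \<Rightarrow> 'k triples \<times> 'k triples \<times> 'k triples \<times> 'k triples" where
  "K_table FamA =
    ({(1, i1, i1)},
     {(1, i2, i1), (1, i1, i2)},
     {(1, i1, i2)},
     {(-2, i2, i1), (-1, i1, i2), (1, i2, i2)})"
| "K_table (FamB p) =
    ({(1, i2, i2)},
     {(1, i1, i2)},
     {(-1, i2, i1)},
     {(1, i1, i1)})"
| "K_table (FamC p) =
    ({(-1, i1, i1), (p^2, i2, i1), (1, i1, i2), (-p, i2, i2)},
     {(-p, i1, i1), (1, i2, i1), (1, i1, i2), (-p, i2, i2)},
     {(-p, i1, i1), (-2 * p^2, i2, i1), (p, i1, i2), (-p, i2, i2)},
     {(-p, i1, i1), (p^2, i2, i1), (1, i1, i2), (-1, i2, i2)})"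
| "K_table (FamD p) =
    ({(-p, i1, i1)},
     {(- (p^2), i2, i1), (1, i1, i2)},
     {(p, i1, i2)},
     {(1, i1, i1), (1, i2, i2)})"
| "K_table (FamE p) =
    ({(1, i1, i2), (1, i2, i2)},
     {(1, i1, i2), (-1, i2, i2)},
     {(-1, i1, i1), (1, i2, i1)},
     {(1, i1, i1), (1, i2, i1)})"
| "K_table (FamF p) =
    ({(-1, i1, i1), (-p, i2, i1), (1, i1, i2), (-1, i2, i2)},
     {(-p, i1, i1), (1, i2, i1), (1, i1, i2), (1, i2, i2)},
     {(-p, i1, i1), (p, i2, i1), (p, i1, i2), (1, i2, i2)},
     {(-p, i1, i1), (-p, i2, i1), (1, i1, i2), (-p, i2, i2)})"
| "K_table (FamG p f) =
    ({(p, i1, i1)},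
     {(p, i1, i1), (p^2, i2, i1), (1, i1, i2)},
     {(p, i1, i2)},
     {(f, i1, i1), (-1, i1, i2), (1, i2, i2)})"
| "K_table (FamH f) =
    ({(1, i1, i2)},
     {(f, i1, i2), (1, i2, i2)},
     {(1, i1, i1)},
     {(f, i1, i1), (1, i2, i1)})"
| "K_table (FamI q) =
    ({(-q, i1, i1), (-q, i2, i1), (1, i1, i2), (-q, i2, i2)},
     {(1, i1, i1), (1, i2, i1), (1, i1, i2), (-q, i2, i2)},
     {(1, i1, i1), (q, i2, i1), (q, i1, i2), (-q, i2, i2)},
     {(-1, i1, i1), (-q, i2, i1), (1, i1, i2), (-1, i2, i2)})"
| "K_table (FamJ q) =
    ({(1, i2, i1), (1, i2, i2)},
     {(-1, i1, i1), (1, i1, i2)},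
     {(1, i2, i1), (-1, i2, i2)},
     {(1, i1, i1), (1, i1, i2)})"
| "K_table (FamK q f) =
    ({(1, i1, i1)},
     {(1, i2, i2)},
     {(1, i1, i2)},
     {(f, i2, i1)})"
| "K_table (FamL q f) =
    ({(f, i1, i2)},
     {(1, i2, i2)},
     {(f, i1, i1)},
     {(1, i2, i1)})"
| "K_table (FamM f) =
    ({(1, i2, i1), (1, i1, i2)},
     {(f, i1, i1), (-1, i2, i2)},
     {(1, i1, i1), (-1, i2, i2)},
     {(-1, i2, i1), (-f, i1, i2)})"
| "K_table (FamN f g) =
    ({(-g, i2, i1), (f, i2, i2)},
     {(g, i1, i1), (f, i1, i2)},
     {(f, i2, i1), (-g, i2, i2)},
     {(f, i1, i1), (g, i1, i2)})"
| "K_table (FamO f) =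
    ({(1, i1, i1), (f, i2, i2)},
     {(-1, i2, i1), (1, i1, i2)},
     {(f, i2, i1), (-1, i1, i2)},
     {(1, i1, i1), (1, i2, i2)})"
| "K_table (FamP f) =
    ({(1, i1, i2), (f, i2, i2)},
     {(1, i1, i2), (1, i2, i2)},
     {(1, i1, i1), (-f, i2, i1)},
     {(-1, i1, i1), (1, i2, i1)})"
| "K_table FamQ =
    ({(1, i1, i2)},
     {(1, i1, i1), (1, i2, i1), (1, i1, i2)},
     {(-1, i1, i1)},
     {(1, i1, i1), (-1, i1, i2), (1, i2, i2)})"
| "K_table FamR =
    ({(1, i1, i1), (1, i2, i1), (1, i1, i2)},
     {(1, i1, i2)},
     {(1, i2, i1)},
     {(-1, i2, i1), (-1, i1, i2), (1, i2, i2)})"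
| "K_table FamS =
    ({(-1, i1, i1), (1, i2, i1), (1, i1, i2), (1, i2, i2)},
     {(1, i1, i1), (-1, i2, i1), (1, i1, i2), (1, i2, i2)},
     {(1, i1, i1), (1, i2, i1), (-1, i1, i2), (1, i2, i2)},
     {(1, i1, i1), (1, i2, i1), (1, i1, i2), (-1, i2, i2)})"
| "K_table FamT =
    ({(-1, i1, i1), (1, i2, i1), (1, i1, i2), (1, i2, i2)},
     {(1, i1, i1), (-1, i2, i1), (1, i1, i2), (1, i2, i2)},
     {(1, i1, i1), (1, i2, i1), (1, i1, i2), (-1, i2, i2)},
     {(1, i1, i1), (1, i2, i1), (-1, i1, i2), (1, i2, i2)})"
| "K_table FamU =
    ({(-1, i1, i1), (1, i2, i1), (1, i1, i2), (1, i2, i2)},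
     {(1, i1, i1), (1, i2, i1), (1, i1, i2), (-1, i2, i2)},
     {(1, i1, i1), (1, i2, i1), (-1, i1, i2), (1, i2, i2)},
     {(1, i1, i1), (-1, i2, i1), (1, i1, i2), (1, i2, i2)})"
| "K_table FamV =
    ({(1, i2, i1), (1, i1, i2)},
     {(1, i2, i1)},
     {(-1, i1, i1), (1, i2, i1)},
     {(1, i2, i2)})"
| "K_table (FamW f) =
    ({(f, i2, i1), (1, i1, i2)},
     {(1, i1, i1), (-1, i2, i2)},
     {(1, i1, i1), (f, i2, i2)},
     {(-1, i2, i1), (1, i1, i2)})"
| "K_table FamX =
    ({(1, i1, i2)},
     {(1, i1, i2), (1, i2, i2)},
     {(1, i1, i1)},
     {(1, i1, i1), (1, i2, i1)})"
| "K_table (FamY f) =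
    ({(1, i1, i1)},
     {(f, i1, i1), (-1, i2, i1), (1, i1, i2)},
     {(1, i1, i2)},
     {(1, i1, i1), (f, i1, i2), (-1, i2, i2)})"
| "K_table (FamZ f) =
    ({(1, i1, i1), (1, i2, i2)},
     {(1, i2, i1), (1, i1, i2)},
     {(f, i2, i1), (-1, i1, i2)},
     {(f, i1, i1), (-1, i2, i2)})"

definition K_set :: "'k::field family \<Rightarrow> idx \<Rightarrow> idx \<Rightarrow> 'k triples" where
  "K_set F i s = (case K_table F of (k11, k12, k21, k22) \<Rightarrow>
     (case i of
        i1 \<Rightarrow> (case s of i1 \<Rightarrow> k11 | i2 \<Rightarrow> k12)
      | i2 \<Rightarrow> (case s of i1 \<Rightarrow> k21 | i2 \<Rightarrow> k22)))"


section \<open>The algebras of a family and its admissible parameters\<close>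

text \<open>The element \<open>u\<^sub>2 u\<^sub>1 - (a u\<^sub>1 u\<^sub>2 + b u\<^sub>1\<^sup>2)\<close>.\<close>

definition skew_relator ::
  "'k::field \<times> 'k \<Rightarrow> (idx \<Rightarrow> ('g, 'k) free_alg) \<Rightarrow> ('g, 'k) free_alg" where
  "skew_relator ab u =
     u i2 * u i1 - (const (fst ab) * u i1 * u i2 + const (snd ab) * u i1 ^ 2)"

definition R_relators :: "'k::field family \<Rightarrow> (idx, 'k) free_alg set" where
  "R_relators F = {skew_relator (x_scalars F) gen}"

definition R_alg :: "'k::field family \<Rightarrow> ('k, (idx, 'k) free_alg set) module" where
  "R_alg F = presented_alg (R_relators F)"

datatype letter = Lx idx | Ly idx

definition B_relators :: "'k::field family \<Rightarrow> (letter, 'k) free_alg set" where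
  "B_relators F =
     {skew_relator (x_scalars F) (\<lambda>t. gen (Lx t)), skew_relator (y_scalars F) (\<lambda>l. gen (Ly l))} \<union>
     {gen (Ly i) * gen (Lx s) - (\<Sum>(c, t, l)\<in>K_set F i s. const c * gen (Lx t) * gen (Ly l)) | i s. True}"

definition B_alg :: "'k::field family \<Rightarrow> ('k, (letter, 'k) free_alg set) module" where
  "B_alg F = presented_alg (B_relators F)"

definition xR :: "'k::field family \<Rightarrow> idx \<Rightarrow> (idx, 'k) free_alg set" where
  "xR F t = cls (R_relators F) (gen t)"

definition xB :: "'k::field family \<Rightarrow> idx \<Rightarrow> (letter, 'k) free_alg set" where
  "xB F t = cls (B_relators F) (gen (Lx t))"

definition yB :: "'k::field family \<Rightarrow> idx \<Rightarrow> (letter, 'k) free_alg set" where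
  "yB F l = cls (B_relators F) (gen (Ly l))"

definition admissible :: "'k::field family \<Rightarrow> bool" where
  "admissible F \<longleftrightarrow>
     q_of F \<noteq> 0 \<and> p_of F \<noteq> 0 \<and>
     (\<exists>\<iota>. (\<forall>t. \<iota> (xR F t) = xB F t) \<and>
          trimmed_double_extension (R_alg F) (B_alg F) \<iota> (yB F))"


section \<open>Normal forms and structure constants\<close>

type_synonym exponents = "nat \<times> nat \<times> nat \<times> nat"

definition monomial :: "'k::field family \<Rightarrow> exponents \<Rightarrow> (letter, 'k) free_alg set" where
  "monomial F = (\<lambda>(a, b, c, d).
     xB F i1 [^]\<^bsub>B_alg F\<^esub> a \<otimes>\<^bsub>B_alg F\<^esub> xB F i2 [^]\<^bsub>B_alg F\<^esub> b \<otimes>\<^bsub>B_alg F\<^esub>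
     yB F i1 [^]\<^bsub>B_alg F\<^esub> c \<otimes>\<^bsub>B_alg F\<^esub> yB F i2 [^]\<^bsub>B_alg F\<^esub> d)"

definition is_expansion ::
  "'k::field family \<Rightarrow> (letter, 'k) free_alg set \<Rightarrow> (exponents \<Rightarrow> 'k) \<Rightarrow> bool" where
  "is_expansion F u e \<longleftrightarrow>
     finite {m. e m \<noteq> 0} \<and>
     u = (\<Oplus>\<^bsub>B_alg F\<^esub>m\<in>{m. e m \<noteq> 0}. e m \<odot>\<^bsub>B_alg F\<^esub> monomial F m)"

text \<open>For admissible \<open>F\<close> the monomials form a basis, so the description below is proper.\<close>

definition NF :: "'k::field family \<Rightarrow> (letter, 'k) free_alg set \<Rightarrow> exponents \<Rightarrow> 'k" where
  "NF F u = (THE e. is_expansion F u e)"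

text \<open>\<open>Theta F (a, b, c, d) (\<alpha>, \<beta>, \<gamma>, \<delta>)\<close> is the coefficient \<open>\<Theta>(a,b;c,d;\<alpha>,\<beta>;\<gamma>,\<delta>)\<close>.\<close>

definition Theta :: "'k::field family \<Rightarrow> exponents \<Rightarrow> exponents \<Rightarrow> 'k" where
  "Theta F = (\<lambda>(a, b, c, d).
     NF F (yB F i1 [^]\<^bsub>B_alg F\<^esub> c \<otimes>\<^bsub>B_alg F\<^esub> yB F i2 [^]\<^bsub>B_alg F\<^esub> d \<otimes>\<^bsub>B_alg F\<^esub>
           xB F i1 [^]\<^bsub>B_alg F\<^esub> a \<otimes>\<^bsub>B_alg F\<^esub> xB F i2 [^]\<^bsub>B_alg F\<^esub> b))"

definition qint :: "'k::field \<Rightarrow> nat \<Rightarrow> 'k" where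
  "qint q n = (\<Sum>j<n. q ^ j)"

text \<open>
  For natural \<open>k\<close> the term with lower index \<open>k - 1\<close> drops out of the recursion at \<open>k = 0\<close>, and the
  vanishing for \<open>k > n\<close> follows from the equations.
\<close>

fun qbinom :: "'k::field \<Rightarrow> nat \<Rightarrow> nat \<Rightarrow> 'k" where
  "qbinom q 0 0 = 1"
| "qbinom q 0 (Suc k) = 0"
| "qbinom q (Suc n) 0 = q ^ 0 * qbinom q n 0"
| "qbinom q (Suc n) (Suc k) = qbinom q n k + q ^ Suc k * qbinom q n (Suc k)"

lemma qbinom_eq_0: "n < k \<Longrightarrow> qbinom q n k = 0"
  by (induction q n k rule: qbinom.induct) auto

definition qrising :: "'k::field \<Rightarrow> nat \<Rightarrow> nat \<Rightarrow> 'k" where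
  "qrising q m k = (\<Prod>j<k. qint q (m + j))"

definition Lambda :: "'k::field \<Rightarrow> 'k \<Rightarrow> nat \<Rightarrow> nat \<Rightarrow> nat \<Rightarrow> 'k" where
  "Lambda q r n m k =
     (if k > n then 0 else r ^ k * q ^ (m * (n - k)) * qbinom q n k * qrising q m k)"

text \<open>
  \<^const>\<open>Sum_any\<close> sums over the support of its argument. The support is finite here, since
  \<^const>\<open>Theta\<close> has finite support in \<open>(\<alpha>, \<beta>, \<gamma>, \<delta>)\<close> and \<^const>\<open>Lambda\<close> vanishes for \<open>r > b\<close>, \<open>s > \<delta>\<close>.
  Differences of exponents are taken in the integers.
\<close>

definition mconst :: "'k::field family \<Rightarrow> exponents \<Rightarrow> exponents \<Rightarrow> exponents \<Rightarrow> 'k" where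
  "mconst F = (\<lambda>(a, b, c, d) (a', b', c', d') (A, B, C, D).
     Sum_any (\<lambda>(\<alpha>, \<beta>, \<gamma>, \<delta>, r, s).
       Theta F (a', b', c, d) (\<alpha>, \<beta>, \<gamma>, \<delta>) *
       Lambda (q_of F) (r_of F) b \<alpha> r * Lambda (p_of F) (s_of F) \<delta> c' s *
       of_bool (A = a + \<alpha> + r) * of_bool (int B = int b - int r + int \<beta>) *
       of_bool (C = \<gamma> + c' + s) * of_bool (int D = int \<delta> - int s + int d')))"

definition linear_form ::
  "'k::field family \<Rightarrow> 'k \<Rightarrow> 'k \<Rightarrow> 'k \<Rightarrow> 'k \<Rightarrow> (letter, 'k) free_alg set" where
  "linear_form F lam1 lam2 mu1 mu2 =
     lam1 \<odot>\<^bsub>B_alg F\<^esub> xB F i1 \<oplus>\<^bsub>B_alg F\<^esub> lam2 \<odot>\<^bsub>B_alg F\<^esub> xB F i2 \<oplus>\<^bsub>B_alg F\<^esub>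
     mu1 \<odot>\<^bsub>B_alg F\<^esub> yB F i1 \<oplus>\<^bsub>B_alg F\<^esub> mu2 \<odot>\<^bsub>B_alg F\<^esub> yB F i2"

end

theory Submission
  imports Defs
begin

text \<open>
  Admissibility makes the monomials \<open>x\<^sub>1\<^sup>a x\<^sub>2\<^sup>b y\<^sub>1\<^sup>c y\<^sub>2\<^sup>d\<close> a basis: the algebra is left free over
  the skew plane on \<open>y\<^sub>1\<^sup>c y\<^sub>2\<^sup>d\<close>, and the skew plane has the basis \<open>x\<^sub>1\<^sup>a x\<^sub>2\<^sup>b\<close>. In a product of
  two monomials the inner factor \<open>y\<^sub>1\<^sup>c y\<^sub>2\<^sup>d x\<^sub>1\<^sup>a x\<^sub>2\<^sup>b\<close> is expanded by \<open>\<Theta>\<close>, which leaves only the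
  powers \<open>x\<^sub>2\<^sup>n x\<^sub>1\<^sup>m\<close> and \<open>y\<^sub>2\<^sup>n y\<^sub>1\<^sup>m\<close> to be reordered, and these reorder with the coefficients \<open>\<Lambda>\<close>.
  So the product constants are the coordinates of products of basis monomials, and the recurrence is
  \<open>L\<^sup>N\<^sup>+\<^sup>1 = L\<^sup>N L\<close> in coordinates. Computations take place in the free algebra, modulo equality of
  classes.
\<close>

text \<open>A finitely supported function is the finite sum of its single terms, so an additive
  property of the free algebra need only be checked on scalar multiples of one word. The empty sum
  is a single term with coefficient 0.\<close>

lemma poly_mapping_add_induct [case_names single add]:
  assumes single: "\<And>k c. P (Poly_Mapping.single k c)"
    and add: "\<And>f g. P f \<Longrightarrow> P g \<Longrightarrow> P (f + g)"
  shows "P (f :: 'a \<Rightarrow>\<^sub>0 'b::comm_monoid_add)"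
proof -
  have "P (\<Sum>k\<in>A. Poly_Mapping.single k (Poly_Mapping.lookup f k))" if "finite A" for A
    using that
  proof induction
    case empty
    then show ?case using single[of _ 0] by simp
  next
    case (insert k A)
    then show ?case using add[OF single[of k] insert.IH] by simp
  qed
  moreover have "(\<Sum>k\<in>Poly_Mapping.keys f. Poly_Mapping.single k (Poly_Mapping.lookup f k)) = f"
    by (rule poly_mapping_eqI) (simp add: lookup_sum lookup_single when_def in_keys_iff)
  ultimately show ?thesis by (metis finite_keys)
qed

section \<open>Presented algebras\<close>

lemma const_0 [simp]: "const 0 = 0"
  and const_1 [simp]: "const 1 = 1"
  and const_add: "const (c + d) = const c + const d"
  and const_mult: "const (c * d) = const c * const d"
  and const_uminus: "const (- c) = - const c"
  by (simp_all add: const_def single_add mult_single single_uminus)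

text \<open>The empty word is neutral on both sides and the field is commutative, so scalars are
  central although the free algebra is not commutative.\<close>

lemma const_commute: "w * const c = const c * w"
  by (induction w rule: poly_mapping_add_induct)
     (simp_all add: const_def mult_single mult.commute distrib_left distrib_right)

lemma const_left_commute: "w * (const c * v) = const c * (w * v)"
  by (simp add: const_commute[of w] flip: mult.assoc)

lemma const_merge: "const c * (w * (const d * v)) = const (c * d) * (w * v)"
  by (simp add: const_left_commute[of w] const_mult mult.assoc)

section \<open>Type-class rings as ring records\<close>

lemma ring_of_type_algebra_simps [simp]:
  "carrier ring_of_type_algebra = UNIV"
  "x \<otimes>\<^bsub>ring_of_type_algebra\<^esub> y = x * y"
  "x \<oplus>\<^bsub>ring_of_type_algebra\<^esub> y = x + y"
  "\<one>\<^bsub>ring_of_type_algebra\<^esub> = 1"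
  "\<zero>\<^bsub>ring_of_type_algebra\<^esub> = 0"
  by (simp_all add: ring_of_type_algebra_def)

lemma ring_ring_of_type_algebra: "ring (ring_of_type_algebra :: 'a::ring_1 ring)"
proof -
  have "\<exists>y. x + y = 0" for x :: 'a
    by (rule exI[of _ "- x"]) simp
  then show ?thesis
    unfolding ring_of_type_algebra_def
    by unfold_locales (auto simp: algebra_simps Units_def add_eq_0_iff)
qed

lemma a_minus_ring_of_type_algebra [simp]:
  "x \<ominus>\<^bsub>ring_of_type_algebra\<^esub> y = x - (y :: 'a::ring_1)"
proof -
  interpret ring "ring_of_type_algebra :: 'a ring" by (rule ring_ring_of_type_algebra)
  have "\<ominus>\<^bsub>ring_of_type_algebra\<^esub> y = - y"
    using minus_equality[of "- y" y] by simp
  then show ?thesis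
    by (simp add: a_minus_def)
qed

lemma ideal_Idl: "ideal (Idl\<^bsub>ring_of_type_algebra\<^esub> S) (ring_of_type_algebra :: 'a::ring_1 ring)"
  by (rule ring.genideal_ideal[OF ring_ring_of_type_algebra]) simp

section \<open>The quotient, computed on representatives\<close>

lemma cls_hom: "ring_hom_ring ring_of_type_algebra (presented_ring S) (cls S)"
proof -
  have "cls S = (+>\<^bsub>ring_of_type_algebra\<^esub>) (Idl\<^bsub>ring_of_type_algebra\<^esub> S)"
    by (simp add: cls_def fun_eq_iff)
  then show ?thesis
    unfolding presented_ring_def using ideal.rcos_ring_hom_ring[OF ideal_Idl] by metis
qed

lemma cls_eq_iff: "cls S u = cls S v \<longleftrightarrow> u - v \<in> Idl\<^bsub>ring_of_type_algebra\<^esub> S"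
  unfolding cls_def
  using ring.quotient_eq_iff_same_a_r_cos[OF ring_ring_of_type_algebra ideal_Idl, of u v S] by simp

lemma presented_alg_simps:
  "carrier (presented_alg S) = range (cls S)"
  "cls S u \<otimes>\<^bsub>presented_alg S\<^esub> cls S v = cls S (u * v)"
  "cls S u \<oplus>\<^bsub>presented_alg S\<^esub> cls S v = cls S (u + v)"
  "\<one>\<^bsub>presented_alg S\<^esub> = cls S 1"
  "\<zero>\<^bsub>presented_alg S\<^esub> = cls S 0"
  "c \<odot>\<^bsub>presented_alg S\<^esub> cls S u = cls S (const c * u)"
proof -
  interpret h: ring_hom_ring ring_of_type_algebra "presented_ring S" "cls S"
    by (rule cls_hom)
  have "carrier (presented_ring S) = range (cls S)"
    by (auto simp: presented_ring_def FactRing_def A_RCOSETS_def' cls_def)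
  then show "carrier (presented_alg S) = range (cls S)"
    by (simp add: presented_alg_def)
  show "cls S u \<otimes>\<^bsub>presented_alg S\<^esub> cls S v = cls S (u * v)"
    "cls S u \<oplus>\<^bsub>presented_alg S\<^esub> cls S v = cls S (u + v)"
    "\<one>\<^bsub>presented_alg S\<^esub> = cls S 1"
    "\<zero>\<^bsub>presented_alg S\<^esub> = cls S 0"
    "c \<odot>\<^bsub>presented_alg S\<^esub> cls S u = cls S (const c * u)"
    using h.hom_mult[of u v] h.hom_add[of u v] h.hom_one h.hom_zero h.hom_mult[of "const c" u]
    by (simp_all add: presented_alg_def)
qed

lemma presented_alg_pow: "cls S u [^]\<^bsub>presented_alg S\<^esub> (n::nat) = cls S (u ^ n)"
  by (induction n) (simp_all add: presented_alg_simps power_commutes)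

lemma abelian_monoid_presented_alg: "abelian_monoid (presented_alg S)"
  by (rule abelian_monoidI) (auto simp: presented_alg_simps add_ac)

lemma presented_alg_finsum:
  "(\<Oplus>\<^bsub>presented_alg S\<^esub>i\<in>A. cls S (f i)) = cls S (sum f A)"
proof -
  interpret abelian_monoid "presented_alg S"
    by (rule abelian_monoid_presented_alg)
  have closed: "cls S (f i) \<in> carrier (presented_alg S)" for i
    by (simp add: presented_alg_simps)
  show ?thesis
  proof (induction A rule: infinite_finite_induct)
    case (insert x A)
    have "(\<Oplus>\<^bsub>presented_alg S\<^esub>i\<in>insert x A. cls S (f i)) =
        cls S (f x) \<oplus>\<^bsub>presented_alg S\<^esub> cls S (sum f A)"
      unfolding insert.IH[symmetric] by (rule finsum_insert) (use insert closed in auto)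
    then show ?case
      using insert by (simp add: presented_alg_simps)
  \<comment> \<open>Over an infinite index set both kinds of sum are zero by convention.\<close>
  qed (simp_all add: presented_alg_simps finsum_infinite)
qed

text \<open>With its companions for products and finite sums, this makes equality of classes a
  congruence, so relations may be applied inside larger expressions.\<close>

lemma cls_add: "cls S u = cls S u' \<Longrightarrow> cls S v = cls S v' \<Longrightarrow> cls S (u + v) = cls S (u' + v')"
  by (metis presented_alg_simps(3))

lemma cls_mult: "cls S u = cls S u' \<Longrightarrow> cls S v = cls S v' \<Longrightarrow> cls S (u * v) = cls S (u' * v')"
  by (metis presented_alg_simps(2))

lemma cls_sum: "(\<And>i. i \<in> A \<Longrightarrow> cls S (f i) = cls S (g i)) \<Longrightarrow> cls S (sum f A) = cls S (sum g A)"
proof (induction A rule: infinite_finite_induct)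
  case (insert x A)
  then show ?case by (simp add: cls_add[of S "f x" "g x" "sum f A" "sum g A"])
qed simp_all

lemma cls_relation: "u - v \<in> S \<Longrightarrow> cls S u = cls S v"
  unfolding cls_eq_iff using ring.genideal_self[OF ring_ring_of_type_algebra, of S] by auto

section \<open>Straightening a skew commutation relation\<close>

lemma qint_Suc: "qint q (Suc n) = qint q n + q ^ n"
  by (simp add: qint_def)

lemma qint_Suc_shift: "qint q (Suc n) = 1 + q * qint q n"
  by (simp only: qint_def sum.lessThan_Suc_shift sum_distrib_left) simp

lemma qint_0 [simp]: "qint q 0 = 0"
  by (simp add: qint_def)

text \<open>This is what happens when one more \<open>u2\<close> meets \<open>u1 ^ (m + k)\<close>:
  it either passes, with factor \<open>q ^ (m + k)\<close>, or is absorbed into a further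
  \<open>u1\<close>, with factor \<open>r * qint q (m + k)\<close>. The two outcomes match the two
  terms of the q-Pascal rule.\<close>

lemma Lambda_Suc:
  "Lambda q r (Suc n) m k = Lambda q r n m k * q ^ (m + k) +
     (case k of 0 \<Rightarrow> 0 | Suc j \<Rightarrow> Lambda q r n m j * (r * qint q (m + j)))"
proof (cases k)
  case 0
  then show ?thesis
    by (simp add: Lambda_def qrising_def algebra_simps power_add)
next
  case (Suc j)
  \<comment> \<open>Only for \<open>j < n\<close> is \<open>n - j\<close> a successor, which
    releases the factor \<open>q ^ m\<close>. For \<open>j = n\<close> only the absorbed term
    survives, and beyond that everything vanishes.\<close>
  consider "j < n" | "j = n" | "j > n" by linarith
  then show ?thesis
  proof cases
    case 1
    then have "n - j = Suc (n - Suc j)" by simp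
    with 1 Suc show ?thesis
      by (simp add: Lambda_def qrising_def algebra_simps power_add)
  qed (simp_all add: Suc Lambda_def qrising_def qbinom_eq_0 algebra_simps)
qed

context
  fixes S :: "('g, 'k::field) free_alg set" and q r u1 u2
  assumes rel: "cls S (u2 * u1) = cls S (const q * u1 * u2 + const r * u1 ^ 2)"
begin

text \<open>Appending one more \<open>u1\<close> multiplies the passing term by \<open>q\<close> and
  adds \<open>r * q ^ m\<close> to the coefficient of the pure power of \<open>u1\<close>, which is
  the next summand of the q-integer.\<close>

lemma skew_commute_power:
  "cls S (u2 * u1 ^ m) = cls S (const (q ^ m) * u1 ^ m * u2 + const (r * qint q m) * u1 ^ Suc m)"
proof (induction m)
  case (Suc m)
  have "cls S (u2 * u1 ^ Suc m) = cls S ((u2 * u1 ^ m) * u1)"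
    by (simp add: mult.assoc power_commutes)
  also have "\<dots> = cls S ((const (q ^ m) * u1 ^ m * u2 + const (r * qint q m) * u1 ^ Suc m) * u1)"
    by (rule cls_mult) (simp_all add: Suc)
  also have "\<dots> = cls S (const (q ^ m) * u1 ^ m * (u2 * u1) + const (r * qint q m) * u1 ^ Suc m * u1)"
    by (simp add: algebra_simps)
  also have "\<dots> = cls S (const (q ^ m) * u1 ^ m * (const q * u1 * u2 + const r * u1 ^ 2)
      + const (r * qint q m) * u1 ^ Suc m * u1)"
    by (intro cls_add cls_mult rel refl)
  also have "const (q ^ m) * u1 ^ m * (const q * u1 * u2 + const r * u1 ^ 2)
      + const (r * qint q m) * u1 ^ Suc m * u1 =
      const (q ^ Suc m) * u1 ^ Suc m * u2 + const (r * qint q (Suc m)) * u1 ^ Suc (Suc m)"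
    unfolding qint_Suc power_Suc2[of u1] power_Suc2[of q] power2_eq_square
    by (simp add: distrib_left distrib_right const_add mult.assoc const_merge add.assoc add.commute mult.commute[of r])
  finally show ?case .
qed simp

text \<open>Induction on \<open>n\<close>, with each new \<open>u2\<close> put in front. Since
  \<open>u1\<close> and \<open>u2\<close> are arbitrary elements of the free algebra, the result
  serves the \<open>x\<close> pair and the \<open>y\<close> pair alike.\<close>

lemma straighten:
  "cls S (u2 ^ n * u1 ^ m) = cls S (\<Sum>k\<le>n. const (Lambda q r n m k) * u1 ^ (m + k) * u2 ^ (n - k))"
proof (induction n)
  case 0
  then show ?case by (simp add: Lambda_def qrising_def)
next
  case (Suc n)
  \<comment> \<open>\<open>G\<close> collects the terms in which the new \<open>u2\<close> passes,
    \<open>H\<close> those in which it is absorbed. Absorption raises the power of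
    \<open>u1\<close>, so \<open>H\<close> is indexed by the resulting exponent and is zero at
    0.\<close>
  define G where "G k = const (Lambda q r n m k * q ^ (m + k)) * u1 ^ (m + k) * u2 ^ (Suc n - k)" for k
  define H where "H k = const (case k of 0 \<Rightarrow> 0 | Suc j \<Rightarrow> Lambda q r n m j * (r * qint q (m + j))) *
      u1 ^ (m + k) * u2 ^ (Suc n - k)" for k
  have GH: "const (Lambda q r n m k) * (const (q ^ (m + k)) * u1 ^ (m + k) * u2
      + const (r * qint q (m + k)) * u1 ^ Suc (m + k)) * u2 ^ (n - k) = G k + H (Suc k)" if "k \<le> n" for k
    using that by (simp add: G_def H_def Suc_diff_le distrib_left distrib_right const_mult mult.assoc)
  have "cls S (u2 ^ Suc n * u1 ^ m) = cls S (u2 * (u2 ^ n * u1 ^ m))"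
    by (simp add: mult.assoc)
  also have "\<dots> = cls S (u2 * (\<Sum>k\<le>n. const (Lambda q r n m k) * u1 ^ (m + k) * u2 ^ (n - k)))"
    by (intro cls_mult Suc refl)
  also have "\<dots> = cls S (\<Sum>k\<le>n. const (Lambda q r n m k) * (u2 * u1 ^ (m + k)) * u2 ^ (n - k))"
    by (simp add: sum_distrib_left mult.assoc const_left_commute[of u2])
  also have "\<dots> = cls S (\<Sum>k\<le>n. const (Lambda q r n m k) * (const (q ^ (m + k)) * u1 ^ (m + k) * u2
      + const (r * qint q (m + k)) * u1 ^ Suc (m + k)) * u2 ^ (n - k))"
    by (intro cls_sum cls_mult skew_commute_power refl)
  also have "\<dots> = cls S ((\<Sum>k\<le>n. G k) + (\<Sum>k\<le>n. H (Suc k)))"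
    unfolding sum.distrib[symmetric] by (intro arg_cong[of _ _ "cls S"] sum.cong refl GH) simp
  \<comment> \<open>The added term vanishes because \<open>Lambda q r n m k\<close> is 0 for
    \<open>k > n\<close>.\<close>
  also have "(\<Sum>k\<le>n. G k) = (\<Sum>k\<le>Suc n. G k)"
    by (simp add: G_def Lambda_def)
  also have "(\<Sum>k\<le>n. H (Suc k)) = (\<Sum>k\<le>Suc n. H k)"
    by (subst sum.atMost_Suc_shift) (simp add: H_def)
  also have "(\<Sum>k\<le>Suc n. G k) + (\<Sum>k\<le>Suc n. H k) =
      (\<Sum>k\<le>Suc n. const (Lambda q r (Suc n) m k) * u1 ^ (m + k) * u2 ^ (Suc n - k))"
    by (simp only: G_def H_def Lambda_Suc const_add distrib_right sum.distrib)
  finally show ?case .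
qed

end

section \<open>Expansions\<close>

definition lin :: "('m \<Rightarrow> ('g, 'k::field) free_alg) \<Rightarrow> ('m \<Rightarrow> 'k) \<Rightarrow> ('g, 'k) free_alg" where
  "lin M e = (\<Sum>m | e m \<noteq> 0. const (e m) * M m)"

text \<open>A form of \<open>is_expansion\<close> for arbitrary relators and monomials, so that the
  skew plane and the full algebra share one theory.\<close>

definition expands ::
  "('g, 'k::field) free_alg set \<Rightarrow> ('m \<Rightarrow> ('g, 'k) free_alg) \<Rightarrow> ('g, 'k) free_alg \<Rightarrow> ('m \<Rightarrow> 'k) \<Rightarrow> bool"
  where "expands S M u e \<longleftrightarrow> finite {m. e m \<noteq> 0} \<and> cls S u = cls S (lin M e)"

lemma lin_superset:
  assumes "finite A" "{m. e m \<noteq> 0} \<subseteq> A"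
  shows "lin M e = (\<Sum>m\<in>A. const (e m) * M m)"
  unfolding lin_def using assms by (intro sum.mono_neutral_left) auto

lemma finite_support_sum:
  assumes "finite {m. e m \<noteq> 0}" "finite {m. f m \<noteq> 0}"
  shows "finite {m. e m + f m \<noteq> (0::'a::comm_monoid_add)}"
  by (rule finite_subset[OF _ finite_UnI[OF assms]]) auto

lemma lin_add:
  assumes "finite {m. e m \<noteq> 0}" "finite {m. f m \<noteq> 0}"
  shows "lin M (\<lambda>m. e m + f m) = lin M e + lin M f"
proof -
  define A where "A = {m. e m \<noteq> 0} \<union> {m. f m \<noteq> 0}"
  have "finite A" "{m. e m \<noteq> 0} \<subseteq> A" "{m. f m \<noteq> 0} \<subseteq> A" "{m. e m + f m \<noteq> 0} \<subseteq> A"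
    using assms by (auto simp: A_def)
  then show ?thesis
    by (simp add: lin_superset[of A] const_add distrib_right sum.distrib)
qed

lemma lin_smult: "lin M (\<lambda>m. c * e m) = const c * lin M e"
\<comment> \<open>For nonzero \<open>c\<close> the support is unchanged; for \<open>c = 0\<close> it
  collapses to the empty set.\<close>
proof (cases "c = 0")
  case False
  then show ?thesis by (simp add: lin_def sum_distrib_left const_mult mult.assoc)
qed (simp add: lin_def)

lemma expands_cong: "cls S u = cls S v \<Longrightarrow> expands S M u e = expands S M v e"
  by (simp add: expands_def)

lemma expands_0: "expands S M 0 (\<lambda>m. 0)"
  by (simp add: expands_def lin_def)

lemma expands_add:
  "expands S M u e \<Longrightarrow> expands S M v f \<Longrightarrow> expands S M (u + v) (\<lambda>m. e m + f m)"
  by (simp add: expands_def lin_add finite_support_sum cls_add[of S u _ v])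

lemma expands_smult: "expands S M u e \<Longrightarrow> expands S M (const c * u) (\<lambda>m. c * e m)"
  by (auto simp: expands_def lin_smult cls_mult[of S "const c" "const c" u])

lemma expands_self: "expands S M (M m) (\<lambda>m'. of_bool (m' = m))"
  by (simp add: expands_def lin_def)

lemma expands_sum:
  "(\<And>i. i \<in> A \<Longrightarrow> \<exists>e. expands S M (f i) e) \<Longrightarrow> \<exists>e. expands S M (sum f A) e"
proof (induction A rule: infinite_finite_induct)
  case (insert x A)
  then obtain e e' where "expands S M (f x) e" "expands S M (sum f A) e'"
    by blast
  then show ?case
    using expands_add insert.hyps by fastforce
qed (use expands_0 in \<open>auto\<close>)

text \<open>By linearity and centrality of scalars, the span of the monomials is stable under left
  multiplication by \<open>w\<close> once every \<open>w * M m\<close> lies in it.\<close>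

lemma expands_mult_left:
  assumes "expands S M u e" "\<And>m. \<exists>e. expands S M (w * M m) e"
  shows "\<exists>e. expands S M (w * u) e"
proof -
  have "cls S (w * u) = cls S (w * lin M e)"
    using assms(1) by (intro cls_mult) (auto simp: expands_def)
  also have "w * lin M e = (\<Sum>m | e m \<noteq> 0. const (e m) * (w * M m))"
    by (simp add: lin_def sum_distrib_left const_left_commute[of w])
  finally have eq: "cls S (w * u) = cls S (\<Sum>m | e m \<noteq> 0. const (e m) * (w * M m))" .
  have "\<exists>e'. expands S M (\<Sum>m | e m \<noteq> 0. const (e m) * (w * M m)) e'"
    using assms(2) expands_smult by (intro expands_sum) blast
  then show ?thesis
    unfolding expands_cong[OF eq] .
qed

text \<open>Independence is asked only for expansions of 0; uniqueness of all expansions follows by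
  subtraction.\<close>

locale expansion_basis =
  fixes S :: "('g, 'k::field) free_alg set" and M :: "'m \<Rightarrow> ('g, 'k) free_alg"
  assumes spanning: "\<exists>e. expands S M u e"
    and independent: "expands S M 0 e \<Longrightarrow> e m = 0"
begin

lemma expands_unique:
  assumes "expands S M u e" "expands S M u f"
  shows "e = f"
proof
  fix m
  have "expands S M (u + const (-1) * u) (\<lambda>m. e m + (-1) * f m)"
    by (intro expands_add expands_smult assms)
  moreover have "u + const (-1) * u = 0"
    by (simp add: const_uminus)
  ultimately have "e m + (-1) * f m = 0"
    using independent by metis
  then show "e m = f m" by simp
qed

text \<open>The same description as in \<open>NF\<close>, but on representatives; over
  \<open>B_relators F\<close> the two are identified later.\<close>

definition coord :: "('g, 'k) free_alg \<Rightarrow> 'm \<Rightarrow> 'k" where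
  "coord u = (THE e. expands S M u e)"

text \<open>Existence and uniqueness in one equivalence; it turns the closure properties of
  \<open>expands\<close> into linearity of \<open>coord\<close>.\<close>

lemma expands_iff: "expands S M u e \<longleftrightarrow> e = coord u"
proof -
  obtain f where f: "expands S M u f" using spanning by blast
  then have "coord u = f"
    unfolding coord_def using expands_unique by blast
  with f show ?thesis using expands_unique by blast
qed

lemma coord_add: "coord (u + v) m = coord u m + coord v m"
  using expands_add[of S M u "coord u" v "coord v"] by (simp add: expands_iff fun_eq_iff)

lemma coord_smult: "coord (const c * u) m = c * coord u m"
  using expands_smult[of S M u "coord u" c] by (simp add: expands_iff fun_eq_iff)

lemma coord_sum: "coord (sum f A) m = (\<Sum>i\<in>A. coord (f i) m)"
  using expands_0[of S M]
  by (induction A rule: infinite_finite_induct) (simp_all add: coord_add expands_iff fun_eq_iff)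

lemma coord_self: "coord (M m) m' = of_bool (m' = m)"
  using expands_self[of S M m] by (simp add: expands_iff fun_eq_iff)

lemma coord_cong: "cls S u = cls S v \<Longrightarrow> coord u = coord v"
  by (simp add: coord_def expands_def)

lemma finite_coord: "finite {m. coord u m \<noteq> 0}"
  and cls_coord: "cls S u = cls S (\<Sum>m | coord u m \<noteq> 0. const (coord u m) * M m)"
  using expands_iff[of u "coord u"] by (simp_all add: expands_def lin_def)

end

section \<open>A basis of the skew plane\<close>

abbreviation plane_monomial :: "(idx \<Rightarrow> ('g, 'k::field) free_alg) \<Rightarrow> nat \<times> nat \<Rightarrow> ('g, 'k) free_alg" where
  "plane_monomial u \<equiv> \<lambda>(a, b). u i1 ^ a * u i2 ^ b"

lemma cls_skew_relator:
  "skew_relator ab u \<in> S \<Longrightarrow>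
    cls S (u i2 * u i1) = cls S (const (fst ab) * u i1 * u i2 + const (snd ab) * u i1 ^ 2)"
  by (rule cls_relation) (simp add: skew_relator_def)

text \<open>The span contains 1 and is stable under left multiplication by both generators, hence
  contains every word, and sums of words follow.\<close>

lemma expands_plane_monomial:
  "\<exists>e. expands {skew_relator ab gen} (plane_monomial gen) w e"
proof -
  let ?S = "{skew_relator ab gen}"
  let ?M = "plane_monomial (gen :: idx \<Rightarrow> (idx, 'a) free_alg)"
  have gen_mult: "\<exists>e. expands ?S ?M (gen g * ?M m) e" for g m
  proof -
    obtain a b where m: "m = (a, b)" by (cases m)
    show ?thesis
    proof (cases g)
      case i1
      have eq: "gen g * ?M m = ?M (Suc a, b)"
        by (simp add: m i1 mult.assoc)
      have "expands ?S ?M (gen g * ?M m) (\<lambda>m'. of_bool (m' = (Suc a, b)))"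
        unfolding eq by (rule expands_self)
      then show ?thesis by blast
    next
      case i2
      \<comment> \<open>Only the second generator is out of order; carrying it across the power of
        the first gives two ordered monomials.\<close>
      have "cls ?S (gen g * ?M m) = cls ?S ((gen i2 * gen i1 ^ a) * gen i2 ^ b)"
        by (simp add: m i2 mult.assoc)
      also have "\<dots> = cls ?S ((const (fst ab ^ a) * gen i1 ^ a * gen i2
          + const (snd ab * qint (fst ab) a) * gen i1 ^ Suc a) * gen i2 ^ b)"
        by (intro cls_mult refl skew_commute_power cls_skew_relator) simp
      also have "(const (fst ab ^ a) * gen i1 ^ a * gen i2
          + const (snd ab * qint (fst ab) a) * gen i1 ^ Suc a) * gen i2 ^ b
          = const (fst ab ^ a) * ?M (a, Suc b) + const (snd ab * qint (fst ab) a) * ?M (Suc a, b)"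
        by (simp add: distrib_right mult.assoc)
      finally have eq: "cls ?S (gen g * ?M m) = cls ?S (const (fst ab ^ a) * ?M (a, Suc b)
          + const (snd ab * qint (fst ab) a) * ?M (Suc a, b))" .
      show ?thesis
        unfolding expands_cong[OF eq]
        by (rule exI, rule expands_add[OF expands_smult[OF expands_self] expands_smult[OF expands_self]])
    qed
  qed
  have "\<exists>e. expands ?S ?M (Poly_Mapping.single (Word l) c) e" for l c
  proof (induction l)
    case Nil
    have "Poly_Mapping.single (Word []) c = const c * ?M (0, 0)"
      by (simp add: const_def zero_word_def)
    then show ?case using expands_smult[OF expands_self, of ?S ?M c "(0, 0)"] by auto
  next
    case (Cons g l)
    then obtain e where e: "expands ?S ?M (Poly_Mapping.single (Word l) c) e" by blast
    have "Poly_Mapping.single (Word (g # l)) c = gen g * Poly_Mapping.single (Word l) c"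
      by (simp add: gen_def mult_single plus_word_def)
    then show ?case using expands_mult_left[OF e gen_mult] by simp
  qed
  then have *: "\<exists>e. expands ?S ?M (Poly_Mapping.single k c) e" for k c
    by (cases k) simp
  show ?thesis
  proof (induction w rule: poly_mapping_add_induct)
    case (single k c)
    show ?case by (rule *)
  next
    case (add v w)
    then show ?case using expands_add by blast
  qed
qed

text \<open>
  The transpose of left multiplication on the putative basis: if the plane acted on the span of
  \<open>x\<^sub>1\<^sup>a x\<^sub>2\<^sup>b\<close> by left multiplication, a functional \<open>f\<close> on the basis would be sent to
  \<open>m \<mapsto> f (g m)\<close>. Functionals need no finite support.
\<close>

definition skew_op :: "'k::field \<times> 'k \<Rightarrow> idx \<Rightarrow> (nat \<times> nat \<Rightarrow> 'k) \<Rightarrow> nat \<times> nat \<Rightarrow> 'k" where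
  "skew_op ab g f = (\<lambda>(a, b). case g of
      i1 \<Rightarrow> f (Suc a, b)
    | i2 \<Rightarrow> fst ab ^ a * f (a, Suc b) + snd ab * qint (fst ab) a * f (Suc a, b))"

text \<open>The linear extension of \<open>skew_op\<close> to the free algebra. \<open>fold\<close>
  applies the first letter first, because transposition reverses the order of operators; the result
  is a right action.\<close>

definition skew_act ::
  "'k::field \<times> 'k \<Rightarrow> (idx, 'k) free_alg \<Rightarrow> (nat \<times> nat \<Rightarrow> 'k) \<Rightarrow> nat \<times> nat \<Rightarrow> 'k" where
  "skew_act ab p f m =
     (\<Sum>w\<in>Poly_Mapping.keys p. Poly_Mapping.lookup p w * fold (skew_op ab) (letters w) f m)"

lemma skew_op_linear:
  "skew_op ab g (\<lambda>m. c * f m + h m) = (\<lambda>m. c * skew_op ab g f m + skew_op ab g h m)"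
  by (auto simp: skew_op_def algebra_simps fun_eq_iff split: idx.splits)

lemma fold_skew_op_linear:
  "fold (skew_op ab) l (\<lambda>m. c * f m + h m) =
     (\<lambda>m. c * fold (skew_op ab) l f m + fold (skew_op ab) l h m)"
  by (induction l arbitrary: f h) (simp_all add: skew_op_linear)

lemma skew_act_linear:
  "skew_act ab p (\<lambda>m. c * f m + h m) m = c * skew_act ab p f m + skew_act ab p h m"
  by (simp add: skew_act_def fold_skew_op_linear distrib_left mult.left_commute[of _ c] sum.distrib sum_distrib_left)

lemma skew_act_zero_fun: "skew_act ab p (\<lambda>m. 0) m = 0"
  \<comment> \<open>With coefficient \<open>-1\<close> the two terms on the right cancel.\<close>
  using skew_act_linear[of ab p "-1" "\<lambda>m. 0" "\<lambda>m. 0" m] by simp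

lemma skew_act_smult_fun: "skew_act ab p (\<lambda>m. c * f m) m = c * skew_act ab p f m"
  using skew_act_linear[of ab p c f "\<lambda>m. 0" m] by (simp add: skew_act_zero_fun)

lemma skew_act_add: "skew_act ab (p + q) f m = skew_act ab p f m + skew_act ab q f m"
proof -
  \<comment> \<open>Terms of \<open>p + q\<close> may cancel, so all three sums are taken over a
    common set of words.\<close>
  define A where "A = Poly_Mapping.keys p \<union> Poly_Mapping.keys q"
  have *: "skew_act ab s f m = (\<Sum>w\<in>A. Poly_Mapping.lookup s w * fold (skew_op ab) (letters w) f m)"
    if "Poly_Mapping.keys s \<subseteq> A" for s
    unfolding skew_act_def using that
    by (intro sum.mono_neutral_left) (auto simp: A_def in_keys_iff)
  have "Poly_Mapping.keys (p + q) \<subseteq> A" "Poly_Mapping.keys p \<subseteq> A" "Poly_Mapping.keys q \<subseteq> A"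
    using Poly_Mapping.keys_add[of p q] by (auto simp: A_def)
  then show ?thesis
    by (simp add: * lookup_add distrib_right sum.distrib)
qed

lemma skew_act_single:
  "skew_act ab (Poly_Mapping.single w c) f m = c * fold (skew_op ab) (letters w) f m"
  by (cases "c = 0") (simp_all add: skew_act_def)

lemma skew_act_mult: "skew_act ab (p * q) f m = skew_act ab q (skew_act ab p f) m"
proof (induction p arbitrary: m rule: poly_mapping_add_induct)
  case (single k c)
  have p: "skew_act ab (Poly_Mapping.single k c) f = (\<lambda>m. c * fold (skew_op ab) (letters k) f m)"
    by (simp add: fun_eq_iff skew_act_single)
  show ?case
    unfolding p skew_act_smult_fun
  proof (induction q rule: poly_mapping_add_induct)
    case (single k' c')
    then show ?case by (simp add: mult_single skew_act_single plus_word_def)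
  next
    case (add q q')
    then show ?case by (simp only: distrib_left skew_act_add)
  qed
next
  case (add p p')
  have p: "skew_act ab (p + p') f = (\<lambda>m. 1 * skew_act ab p f m + skew_act ab p' f m)"
    by (simp add: fun_eq_iff skew_act_add)
  show ?case
    unfolding p skew_act_linear distrib_right skew_act_add add by simp
qed

lemma skew_act_const: "skew_act ab (const c) f m = c * f m"
  by (simp add: const_def skew_act_single zero_word_def)

lemma skew_act_gen: "skew_act ab (gen g) f = skew_op ab g f"
  by (simp add: gen_def skew_act_single fun_eq_iff)

lemma skew_act_1: "skew_act ab 1 f m = f m"
  using skew_act_const[of ab 1 f m] by simp

lemma skew_act_smult: "skew_act ab (const c * p) f m = c * skew_act ab p f m"
proof -
  have "skew_act ab (const c) f = (\<lambda>m. c * f m)"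
    by (simp add: fun_eq_iff skew_act_const)
  then show ?thesis
    by (simp add: skew_act_mult skew_act_smult_fun)
qed

lemma skew_act_0: "skew_act ab 0 f m = 0"
  by (simp add: skew_act_def)

lemma skew_act_minus: "skew_act ab (p - q) f m = skew_act ab p f m - skew_act ab q f m"
  using skew_act_add[of ab p "const (-1) * q" f m] unfolding skew_act_smult by (simp add: const_uminus)

lemma skew_act_sum: "skew_act ab (sum F A) f m = (\<Sum>i\<in>A. skew_act ab (F i) f m)"
  by (induction A rule: infinite_finite_induct) (simp_all add: skew_act_0 skew_act_add)

text \<open>The coefficients of \<open>f (a + 1, b + 1)\<close> cancel at once, and those of
  \<open>f (a + 2, b)\<close> cancel by \<open>[a + 1] = 1 + q [a]\<close> for the q-integers. Thus
  the action descends to the quotient.\<close>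

lemma skew_act_skew_relator: "skew_act ab (skew_relator ab gen) f m = 0"
  by (cases m)
     (simp add: skew_relator_def skew_act_minus skew_act_add skew_act_mult skew_act_const
        skew_act_gen skew_act_smult_fun power2_eq_square skew_op_def mult.assoc qint_Suc_shift algebra_simps
        skew_act_smult)

lemma skew_act_Idl:
  assumes "p \<in> Idl\<^bsub>ring_of_type_algebra\<^esub> {skew_relator ab gen}"
  shows "skew_act ab p f m = 0"
proof -
  \<comment> \<open>The annihilator of all functionals is a two-sided ideal. In a left multiple
    \<open>x * a\<close> the factor \<open>x\<close> acts first, so \<open>a\<close> must annihilate
    every functional, not one fixed \<open>f\<close>.\<close>
  let ?I = "{p. \<forall>f m. skew_act ab p f m = 0}"
  interpret ring "ring_of_type_algebra :: (idx, 'a) free_alg ring"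
    by (rule ring_ring_of_type_algebra)
  have neg: "\<ominus>\<^bsub>ring_of_type_algebra\<^esub> q = - q" for q :: "(idx, 'a) free_alg"
    using minus_equality[of "- q" q] by simp
  have zero: "skew_act ab p f = (\<lambda>m. 0)" if "p \<in> ?I" for p f
    using that by auto
  have "ideal ?I ring_of_type_algebra"
  proof (rule idealI)
    show "subgroup ?I (add_monoid ring_of_type_algebra)"
    proof (rule add.subgroupI)
      show "?I \<noteq> {}"
        using skew_act_0 by blast
    next
      fix p
      assume p: "p \<in> ?I"
      have "skew_act ab (0 - p) f m = 0" for f m
        unfolding skew_act_minus zero[OF p] by (simp add: skew_act_0)
      then show "\<ominus>\<^bsub>ring_of_type_algebra\<^esub> p \<in> ?I"
        unfolding neg by simp
    qed (simp_all add: skew_act_add)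
  next
    fix a x
    assume "a \<in> ?I"
    then show "x \<otimes>\<^bsub>ring_of_type_algebra\<^esub> a \<in> ?I"
      by (simp add: skew_act_mult)
  next
    fix a x
    assume "a \<in> ?I"
    then show "a \<otimes>\<^bsub>ring_of_type_algebra\<^esub> x \<in> ?I"
      using zero[of a] by (simp add: skew_act_mult skew_act_zero_fun)
  qed (rule ring_axioms)
  moreover have "{skew_relator ab gen} \<subseteq> ?I"
    by (simp add: skew_act_skew_relator)
  ultimately have "Idl\<^bsub>ring_of_type_algebra\<^esub> {skew_relator ab gen} \<subseteq> ?I"
    by (rule genideal_minimal)
  with assms show ?thesis by blast
qed

section \<open>Independence of the plane monomials\<close>

lemma skew_act_power_i1: "skew_act ab (gen i1 ^ n) f (a, b) = f (a + n, b)"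
  by (induction n arbitrary: f)
     (simp_all add: skew_act_mult skew_act_gen skew_op_def skew_act_1)

text \<open>At first exponent 0 the coefficients in \<open>skew_op\<close> are 1 and 0, so the
  second generator merely shifts. Hence a monomial with exponents \<open>(a, b)\<close> sends
  \<open>f\<close> to a functional with value \<open>f (a, b)\<close> at the origin.\<close>

lemma skew_act_power_i2: "skew_act ab (gen i2 ^ n) f (0, b) = f (0, b + n)"
  by (induction n arbitrary: f)
     (simp_all add: skew_act_mult skew_act_gen skew_op_def skew_act_1)

lemma expansion_basis_plane:
  "expansion_basis {skew_relator ab gen} (plane_monomial gen)"
proof
  show "\<exists>e. expands {skew_relator ab gen} (plane_monomial gen) u e" for u
    by (rule expands_plane_monomial)
next
  fix e :: "nat \<times> nat \<Rightarrow> 'a" and m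
  let ?M = "plane_monomial (gen :: idx \<Rightarrow> (idx, 'a) free_alg)"
  assume e: "expands {skew_relator ab gen} ?M 0 e"
  have "lin ?M e \<in> Idl\<^bsub>ring_of_type_algebra\<^esub> {skew_relator ab gen}"
    using e cls_eq_iff[of "{skew_relator ab gen}" "lin ?M e" 0] by (simp add: expands_def)
  \<comment> \<open>The indicator of \<open>m\<close>, acted on and evaluated at the origin, reads
    off the coefficient of \<open>m\<close>.\<close>
  then have "0 = skew_act ab (lin ?M e) (\<lambda>m'. of_bool (m' = m)) (0, 0)"
    by (simp add: skew_act_Idl)
  also have "\<dots> = (\<Sum>m' | e m' \<noteq> 0. e m' * of_bool (m' = m))"
    unfolding lin_def skew_act_sum
    by (intro sum.cong refl)
       (auto simp: skew_act_const skew_act_mult skew_act_power_i1 skew_act_power_i2)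
  also have "\<dots> = e m"
  proof -
    have "(\<Sum>m' | e m' \<noteq> 0. e m' * of_bool (m' = m)) = (\<Sum>m' | e m' \<noteq> 0. if m' = m then e m' else 0)"
      by (intro sum.cong) auto
    also have "\<dots> = e m"
      using e by (subst sum.delta) (auto simp: expands_def)
    finally show ?thesis .
  qed
  finally show "e m = 0" by simp
qed

section \<open>The monomial basis of an admissible algebra\<close>

definition word_monomial :: "exponents \<Rightarrow> (letter, 'k::field) free_alg" where
  "word_monomial = (\<lambda>(a, b, c, d).
     gen (Lx i1) ^ a * gen (Lx i2) ^ b * gen (Ly i1) ^ c * gen (Ly i2) ^ d)"

lemma word_monomial_eq:
  "word_monomial (a, b, c, d) =
     plane_monomial (\<lambda>t. gen (Lx t)) (a, b) * plane_monomial (\<lambda>l. gen (Ly l)) (c, d)"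
  by (simp add: word_monomial_def mult.assoc)

lemma monomial_cls: "monomial F m = cls (B_relators F) (word_monomial m)"
  by (cases m) (simp add: monomial_def word_monomial_def B_alg_def xB_def yB_def presented_alg_pow
      presented_alg_simps)

lemma is_expansion_iff:
  "is_expansion F (cls (B_relators F) u) e \<longleftrightarrow> expands (B_relators F) word_monomial u e"
  by (simp add: is_expansion_def expands_def lin_def monomial_cls B_alg_def presented_alg_simps
      presented_alg_finsum)

lemma left_free_basis_expansion:
  assumes "left_free_basis R B \<iota> e" "b \<in> carrier B"
  shows "\<exists>c. (\<forall>i. c i \<in> carrier R) \<and> finite {i. c i \<noteq> \<zero>\<^bsub>R\<^esub>} \<and>
    b = (\<Oplus>\<^bsub>B\<^esub>i\<in>{i. c i \<noteq> \<zero>\<^bsub>R\<^esub>}. \<iota> (c i) \<otimes>\<^bsub>B\<^esub> e i)"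
  using assms unfolding left_free_basis_def by (elim conjE) (rule ex1_implies_ex, erule bspec)

lemma left_free_basis_unique:
  assumes "left_free_basis R B \<iota> e" "b \<in> carrier B"
    and "\<And>i. c i \<in> carrier R" "finite {i. c i \<noteq> \<zero>\<^bsub>R\<^esub>}"
    and "b = (\<Oplus>\<^bsub>B\<^esub>i\<in>{i. c i \<noteq> \<zero>\<^bsub>R\<^esub>}. \<iota> (c i) \<otimes>\<^bsub>B\<^esub> e i)"
    and "\<And>i. d i \<in> carrier R" "finite {i. d i \<noteq> \<zero>\<^bsub>R\<^esub>}"
    and "b = (\<Oplus>\<^bsub>B\<^esub>i\<in>{i. d i \<noteq> \<zero>\<^bsub>R\<^esub>}. \<iota> (d i) \<otimes>\<^bsub>B\<^esub> e i)"
  shows "c = d"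
proof -
  have "\<exists>!c. (\<forall>i. c i \<in> carrier R) \<and> finite {i. c i \<noteq> \<zero>\<^bsub>R\<^esub>} \<and>
      b = (\<Oplus>\<^bsub>B\<^esub>i\<in>{i. c i \<noteq> \<zero>\<^bsub>R\<^esub>}. \<iota> (c i) \<otimes>\<^bsub>B\<^esub> e i)"
    using assms(1,2) unfolding left_free_basis_def by (elim conjE bspec)
  from this[unfolded ex1_iff_ex_Uniq, THEN conjunct2] show ?thesis
    by (rule Uniq_D) (intro conjI allI assms)+
qed

text \<open>For spanning, the coefficients over the skew plane are themselves expanded in the plane
  basis. For independence, a vanishing combination is grouped by \<open>y\<close> exponents; left
  freeness makes each group zero in the plane, and independence there finishes.\<close>

lemma expansion_basis_B:
  assumes "admissible F"
  shows "expansion_basis (B_relators F) word_monomial"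
proof -
  obtain \<iota> where xR: "\<forall>t. \<iota> (xR F t) = xB F t"
    and tde: "trimmed_double_extension (R_alg F) (B_alg F) \<iota> (yB F)"
    using assms by (auto simp: admissible_def)
  let ?R = "R_relators F" and ?B = "B_relators F"
  let ?X = "plane_monomial (\<lambda>t. gen (Lx t))" and ?Y = "plane_monomial (\<lambda>l. gen (Ly l))"
  note simps = R_alg_def B_alg_def presented_alg_simps
  have hom: "\<iota> \<in> alg_hom (R_alg F) (B_alg F)"
    using trimmed_double_extension.embedding(1)[OF tde] .
  have basis: "left_free_basis (R_alg F) (B_alg F) \<iota> (\<lambda>i. cls ?B (?Y i))"
  proof -
    have "(\<lambda>(i, j). yB F i1 [^]\<^bsub>B_alg F\<^esub> i \<otimes>\<^bsub>B_alg F\<^esub> yB F i2 [^]\<^bsub>B_alg F\<^esub> j) = (\<lambda>i. cls ?B (?Y i))"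
      by (auto simp: fun_eq_iff B_alg_def yB_def presented_alg_pow presented_alg_simps)
    then show ?thesis
      using trimmed_double_extension.left_basis[OF tde] by simp
  qed
  have iota_add: "\<iota> (cls ?R (u + v)) = cls ?B (u' + v')"
    if "\<iota> (cls ?R u) = cls ?B u'" "\<iota> (cls ?R v) = cls ?B v'" for u v u' v'
    using hom ring_hom_add[of \<iota> "R_alg F" "B_alg F" "cls ?R u" "cls ?R v"] that
    by (simp add: alg_hom_def simps)
  have iota_mult: "\<iota> (cls ?R (u * v)) = cls ?B (u' * v')"
    if "\<iota> (cls ?R u) = cls ?B u'" "\<iota> (cls ?R v) = cls ?B v'" for u v u' v'
    using hom ring_hom_mult[of \<iota> "R_alg F" "B_alg F" "cls ?R u" "cls ?R v"] that
    by (simp add: alg_hom_def simps)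
  have iota_1: "\<iota> (cls ?R 1) = cls ?B 1"
    using hom ring_hom_one[of \<iota> "R_alg F" "B_alg F"] by (simp add: alg_hom_def simps)
  have iota_smult: "\<iota> (cls ?R (const c * u)) = cls ?B (const c * u')"
    if "\<iota> (cls ?R u) = cls ?B u'" for c u u'
  proof -
    have "\<iota> (c \<odot>\<^bsub>R_alg F\<^esub> cls ?R u) = c \<odot>\<^bsub>B_alg F\<^esub> \<iota> (cls ?R u)"
      using hom by (auto simp: alg_hom_def simps)
    then show ?thesis by (simp add: simps that)
  qed
  have iota_0: "\<iota> (cls ?R 0) = cls ?B 0"
    using iota_smult[OF iota_1, of 0] by simp
  have iota_power: "\<iota> (cls ?R (gen t ^ n)) = cls ?B (gen (Lx t) ^ n)" for t n
    using spec[OF xR, of t] by (induction n) (simp_all add: iota_1 iota_mult xR_def xB_def)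
  have iota_monomial: "\<iota> (cls ?R (plane_monomial gen m)) = cls ?B (?X m)" for m
    by (cases m) (simp add: iota_mult iota_power)
  \<comment> \<open>Since \<iota> sends generators to generators, a plane expansion keeps its
    coefficients in the larger algebra.\<close>
  have iota_lin: "\<iota> (cls ?R (lin (plane_monomial gen) e)) = cls ?B (lin ?X e)" for e
  proof -
    have "\<iota> (cls ?R (\<Sum>m\<in>A. const (e m) * plane_monomial gen m)) = cls ?B (\<Sum>m\<in>A. const (e m) * ?X m)"
      for A
    proof (induction A rule: infinite_finite_induct)
      case (insert m A)
      then show ?case
        using iota_add[OF iota_smult[OF iota_monomial] insert.IH] by simp
    qed (simp_all add: iota_0)
    then show ?thesis by (simp add: lin_def)
  qed
  interpret P: expansion_basis ?R "plane_monomial gen"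
    unfolding R_relators_def by (rule expansion_basis_plane)
  show ?thesis
  proof
    fix u :: "(letter, 'a) free_alg"
    have "cls ?B u \<in> carrier (B_alg F)"
      by (simp add: simps)
    from left_free_basis_expansion[OF basis this]
    obtain c where "(\<forall>i. c i \<in> carrier (R_alg F)) \<and> finite {i. c i \<noteq> \<zero>\<^bsub>R_alg F\<^esub>} \<and>
        cls ?B u = (\<Oplus>\<^bsub>B_alg F\<^esub>i\<in>{i. c i \<noteq> \<zero>\<^bsub>R_alg F\<^esub>}. \<iota> (c i) \<otimes>\<^bsub>B_alg F\<^esub> cls ?B (?Y i))" ..
    then have c: "\<And>i. c i \<in> carrier (R_alg F)"
        "cls ?B u = (\<Oplus>\<^bsub>B_alg F\<^esub>i\<in>{i. c i \<noteq> \<zero>\<^bsub>R_alg F\<^esub>}. \<iota> (c i) \<otimes>\<^bsub>B_alg F\<^esub> cls ?B (?Y i))"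
      by blast+
    have "\<exists>e. c i = cls ?R (lin (plane_monomial gen) e)" for i
    proof -
      obtain w where "c i = cls ?R w"
        using c(1)[of i] by (auto simp: simps)
      moreover obtain e where "expands ?R (plane_monomial gen) w e"
        using P.spanning by blast
      ultimately show ?thesis by (auto simp: expands_def)
    qed
    then obtain e where e: "\<And>i. c i = cls ?R (lin (plane_monomial gen) (e i))"
      by metis
    define A where "A = {i. c i \<noteq> \<zero>\<^bsub>R_alg F\<^esub>}"
    have "cls ?B u = (\<Oplus>\<^bsub>B_alg F\<^esub>i\<in>A. cls ?B (lin ?X (e i) * ?Y i))"
      unfolding c(2) A_def[symmetric] by (simp only: e iota_lin simps)
    also have "\<dots> = cls ?B (\<Sum>i\<in>A. lin ?X (e i) * ?Y i)"
      unfolding B_alg_def by (rule presented_alg_finsum)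
    finally have eq: "cls ?B u = cls ?B (\<Sum>i\<in>A. lin ?X (e i) * ?Y i)" .
    have "\<exists>f. expands ?B word_monomial (lin ?X (e i) * ?Y i) f" for i
    proof -
      have "\<exists>f. expands ?B word_monomial (const (e i m) * (?X m * ?Y i)) f" for m
      proof -
        have "?X m * ?Y i = word_monomial (fst m, snd m, fst i, snd i)"
          by (cases m, cases i) (simp add: word_monomial_eq)
        then show ?thesis
          using expands_smult[OF expands_self] by metis
      qed
      then have "\<exists>f. expands ?B word_monomial (\<Sum>m | e i m \<noteq> 0. const (e i m) * (?X m * ?Y i)) f"
        by (intro expands_sum)
      then show ?thesis
        by (simp only: lin_def sum_distrib_right mult.assoc)
    qed
    then have "\<exists>f. expands ?B word_monomial (\<Sum>i\<in>A. lin ?X (e i) * ?Y i) f"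
      by (intro expands_sum)
    then show "\<exists>f. expands ?B word_monomial u f"
      unfolding expands_cong[OF eq] .
  next
    fix e :: "exponents \<Rightarrow> 'a" and m
    assume e: "expands ?B word_monomial 0 e"
    define flat :: "(nat \<times> nat) \<times> (nat \<times> nat) \<Rightarrow> exponents"
      where "flat = (\<lambda>((a, b), (c, d)). (a, b, c, d))"
    have inj: "inj_on flat Z" for Z
      by (auto simp: inj_on_def flat_def)
    have mon_flat: "word_monomial (flat (i, j)) = ?X i * ?Y j" for i j
      by (cases i; cases j) (simp add: flat_def word_monomial_eq)
    \<comment> \<open>\<open>A\<close> and \<open>I\<close> are the finite projections of the
      support to the \<open>x\<close> and \<open>y\<close> exponents, so that the support lies in a
      box and the sum can be regrouped.\<close>
    define I where "I = (\<lambda>(a, b, c, d). (c, d)) ` {m. e m \<noteq> 0}"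
    define A where "A = (\<lambda>(a, b, c, d). (a, b)) ` {m. e m \<noteq> 0}"
    have fin: "finite I" "finite A"
      using e by (auto simp: I_def A_def expands_def)
    have supp: "{m. e m \<noteq> 0} \<subseteq> flat ` (A \<times> I)"
    proof
      fix m assume m: "m \<in> {m. e m \<noteq> 0}"
      obtain a b c d where "m = (a, b, c, d)" by (cases m)
      with m have "(a, b) \<in> A" "(c, d) \<in> I" "m = flat ((a, b), (c, d))"
        by (force simp: A_def I_def flat_def)+
      then show "m \<in> flat ` (A \<times> I)" by blast
    qed
    have mem: "i \<in> A" "j \<in> I" if "e (flat (i, j)) \<noteq> 0" for i j
      using supp that inj_image_mem_iff[OF inj[of UNIV], of "(i, j)" "A \<times> I"] by auto
    define f where "f j i = e (flat (i, j))" for j i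
    have supp_f: "{i. f j i \<noteq> 0} \<subseteq> A" for j
      using mem(1) unfolding f_def by blast
    have f_0: "f j = (\<lambda>i. 0)" if "j \<notin> I" for j
      using mem(2) that unfolding f_def by blast
    \<comment> \<open>The coefficient in the plane of the \<open>y\<close> monomial with exponents
      \<open>j\<close>.\<close>
    define c where "c j = cls ?R (lin (plane_monomial gen) (f j))" for j
    let ?C = "{j. c j \<noteq> \<zero>\<^bsub>R_alg F\<^esub>}"
    have C: "?C \<subseteq> I"
      using f_0 by (auto simp: c_def simps lin_def)
    have iota_c: "\<iota> (c j) = cls ?B (lin ?X (f j))" for j
      by (simp only: c_def iota_lin)
    have "(\<Oplus>\<^bsub>B_alg F\<^esub>j\<in>?C. \<iota> (c j) \<otimes>\<^bsub>B_alg F\<^esub> cls ?B (?Y j)) = cls ?B (\<Sum>j\<in>?C. lin ?X (f j) * ?Y j)"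
      unfolding B_alg_def iota_c presented_alg_simps(2) by (rule presented_alg_finsum)
    also have "(\<Sum>j\<in>?C. lin ?X (f j) * ?Y j) = (\<Sum>j\<in>I. if j \<in> ?C then lin ?X (f j) * ?Y j else 0)"
      using C fin by (intro sum.mono_neutral_cong_left) auto
    \<comment> \<open>Outside \<open>?C\<close> only the class of the coefficient is known to
      vanish, not its representative; \<iota> carries the zero class to the zero class, so the
      missing terms may be restored modulo the relations.\<close>
    also have "cls ?B \<dots> = cls ?B (\<Sum>j\<in>I. lin ?X (f j) * ?Y j)"
    proof (intro cls_sum)
      fix j
      show "cls ?B (if j \<in> ?C then lin ?X (f j) * ?Y j else 0) = cls ?B (lin ?X (f j) * ?Y j)"
      proof (cases "j \<in> ?C")
        case False
        then have "cls ?B (lin ?X (f j)) = cls ?B 0"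
          using iota_c[of j] by (simp add: simps iota_0)
        then have "cls ?B (lin ?X (f j) * ?Y j) = cls ?B (0 * ?Y j)"
          by (rule cls_mult) simp
        with False show ?thesis by simp
      qed simp
    qed
    also have "(\<Sum>j\<in>I. lin ?X (f j) * ?Y j) = (\<Sum>j\<in>I. \<Sum>i\<in>A. const (f j i) * (?X i * ?Y j))"
      by (simp only: lin_superset[OF fin(2) supp_f] sum_distrib_right mult.assoc)
    also have "\<dots> = (\<Sum>i\<in>A. \<Sum>j\<in>I. const (f j i) * (?X i * ?Y j))"
      by (rule sum.swap)
    also have "\<dots> = (\<Sum>(i, j)\<in>A \<times> I. const (e (flat (i, j))) * word_monomial (flat (i, j)))"
      by (simp only: sum.cartesian_product f_def mon_flat)
    also have "\<dots> = (\<Sum>m\<in>flat ` (A \<times> I). const (e m) * word_monomial m)"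
      by (simp add: sum.reindex[OF inj] case_prod_unfold)
    also have "\<dots> = lin word_monomial e"
      using fin by (intro lin_superset[OF _ supp, symmetric]) auto
    also have "cls ?B \<dots> = cls ?B 0"
      using e by (simp add: expands_def)
    finally have c_sum: "cls ?B 0 = (\<Oplus>\<^bsub>B_alg F\<^esub>j\<in>?C. \<iota> (c j) \<otimes>\<^bsub>B_alg F\<^esub> cls ?B (?Y j))"
      by (rule sym)
    \<comment> \<open>The zero family also represents 0, by an empty sum, so left freeness forces
      \<open>c\<close> to equal it.\<close>
    define z :: "nat \<times> nat \<Rightarrow> (idx, 'a) free_alg set" where "z j = \<zero>\<^bsub>R_alg F\<^esub>" for j
    have z_sum: "cls ?B 0 = (\<Oplus>\<^bsub>B_alg F\<^esub>j\<in>{j. z j \<noteq> \<zero>\<^bsub>R_alg F\<^esub>}. \<iota> (z j) \<otimes>\<^bsub>B_alg F\<^esub> cls ?B (?Y j))"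
      by (simp add: z_def B_alg_def presented_alg_simps
          abelian_monoid.finsum_empty[OF abelian_monoid_presented_alg])
    have "c = z"
    proof (rule left_free_basis_unique[OF basis])
      show "cls ?B 0 \<in> carrier (B_alg F)" "c j \<in> carrier (R_alg F)" "z j \<in> carrier (R_alg F)" for j
        by (auto simp: c_def z_def simps)
      show "finite ?C" "finite {j. z j \<noteq> \<zero>\<^bsub>R_alg F\<^esub>}"
        using finite_subset[OF C fin(1)] by (simp_all add: z_def)
    qed (fact c_sum z_sum)+
    have "cls ?R (lin (plane_monomial gen) (f j)) = cls ?R 0" for j
      using fun_cong[OF \<open>c = z\<close>, of j] by (simp add: c_def z_def simps)
    then have "f j i = 0" for i j
      using finite_subset[OF supp_f fin(2)]
      by (intro P.independent) (auto simp: expands_def)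
    then have "e (flat (i, j)) = 0" for i j
      by (simp add: f_def)
    then show "e m = 0"
      by (cases m) (auto simp: flat_def)
  qed
qed

section \<open>Structure constants and powers of a linear form\<close>

context
  fixes F :: "'k::field family"
  assumes admissible: "admissible F"
begin

interpretation expansion_basis "B_relators F" word_monomial
  by (rule expansion_basis_B[OF admissible])

section \<open>Normal forms as coordinates\<close>

lemma is_expansion_iff_coord: "is_expansion F (cls (B_relators F) u) e \<longleftrightarrow> e = coord u"
  by (simp add: is_expansion_iff expands_iff)

lemma NF_cls: "NF F (cls (B_relators F) u) = coord u"
  by (simp add: NF_def is_expansion_iff_coord)

lemma Theta_eq:
  "Theta F (a, b, c, d) = coord (gen (Ly i1) ^ c * gen (Ly i2) ^ d * gen (Lx i1) ^ a * gen (Lx i2) ^ b)"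
  by (simp add: Theta_def NF_cls[symmetric] B_alg_def xB_def yB_def presented_alg_pow presented_alg_simps)

lemma straighten_x:
  "cls (B_relators F) (gen (Lx i2) ^ n * gen (Lx i1) ^ m) = cls (B_relators F)
     (\<Sum>k\<le>n. const (Lambda (q_of F) (r_of F) n m k) * gen (Lx i1) ^ (m + k) * gen (Lx i2) ^ (n - k))"
  by (intro straighten cls_skew_relator) (simp add: B_relators_def)

lemma straighten_y:
  "cls (B_relators F) (gen (Ly i2) ^ n * gen (Ly i1) ^ m) = cls (B_relators F)
     (\<Sum>k\<le>n. const (Lambda (p_of F) (s_of F) n m k) * gen (Ly i1) ^ (m + k) * gen (Ly i2) ^ (n - k))"
  by (intro straighten cls_skew_relator) (simp add: B_relators_def)

text \<open>Exactly two blocks are out of order, \<open>x2 ^ b * x1 ^ \<alpha>\<close> and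
  \<open>y2 ^ \<delta> * y1 ^ c\<close>. They do not overlap, so they are straightened independently
  and their coefficients multiply.\<close>

lemma straighten_xy:
  "cls (B_relators F) (gen (Lx i1) ^ a * gen (Lx i2) ^ b * word_monomial (\<alpha>, \<beta>, \<gamma>, \<delta>) *
       gen (Ly i1) ^ c * gen (Ly i2) ^ d) =
   cls (B_relators F) (\<Sum>r\<le>b. \<Sum>s\<le>\<delta>.
       const (Lambda (q_of F) (r_of F) b \<alpha> r * Lambda (p_of F) (s_of F) \<delta> c s) *
       word_monomial (a + \<alpha> + r, b - r + \<beta>, \<gamma> + c + s, \<delta> - s + d))"
proof -
  let ?B = "B_relators F"
  let ?x1 = "gen (Lx i1)" and ?x2 = "gen (Lx i2)" and ?y1 = "gen (Ly i1)" and ?y2 = "gen (Ly i2)"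
  let ?u = "\<lambda>r. const (Lambda (q_of F) (r_of F) b \<alpha> r) * ?x1 ^ (\<alpha> + r) * ?x2 ^ (b - r)"
  let ?v = "\<lambda>s. const (Lambda (p_of F) (s_of F) \<delta> c s) * ?y1 ^ (c + s) * ?y2 ^ (\<delta> - s)"
  have "cls ?B (?x1 ^ a * ?x2 ^ b * word_monomial (\<alpha>, \<beta>, \<gamma>, \<delta>) * ?y1 ^ c * ?y2 ^ d) =
      cls ?B (?x1 ^ a * (?x2 ^ b * ?x1 ^ \<alpha>) * (?x2 ^ \<beta> * ?y1 ^ \<gamma>) * (?y2 ^ \<delta> * ?y1 ^ c) * ?y2 ^ d)"
    by (simp add: word_monomial_def mult.assoc)
  also have "\<dots> = cls ?B (?x1 ^ a * (\<Sum>r\<le>b. ?u r) * (?x2 ^ \<beta> * ?y1 ^ \<gamma>) * (\<Sum>s\<le>\<delta>. ?v s) * ?y2 ^ d)"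
    by (intro cls_mult straighten_x straighten_y refl)
  also have "?x1 ^ a * (\<Sum>r\<le>b. ?u r) * (?x2 ^ \<beta> * ?y1 ^ \<gamma>) * (\<Sum>s\<le>\<delta>. ?v s) * ?y2 ^ d =
      (\<Sum>r\<le>b. \<Sum>s\<le>\<delta>. ?x1 ^ a * ?u r * (?x2 ^ \<beta> * ?y1 ^ \<gamma>) * ?v s * ?y2 ^ d)"
    by (simp only: sum_distrib_left sum_distrib_right) (rule sum.swap)
  also have "\<dots> = (\<Sum>r\<le>b. \<Sum>s\<le>\<delta>.
       const (Lambda (q_of F) (r_of F) b \<alpha> r * Lambda (p_of F) (s_of F) \<delta> c s) *
       word_monomial (a + \<alpha> + r, b - r + \<beta>, \<gamma> + c + s, \<delta> - s + d))"
  proof (intro sum.cong refl)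
    fix r s
    define k l where "k = Lambda (q_of F) (r_of F) b \<alpha> r" and "l = Lambda (p_of F) (s_of F) \<delta> c s"
    have "?x1 ^ a * ?u r * (?x2 ^ \<beta> * ?y1 ^ \<gamma>) * ?v s * ?y2 ^ d =
        const k * ((?x1 ^ a * ?x1 ^ (\<alpha> + r)) * (?x2 ^ (b - r) * ?x2 ^ \<beta>) * ?y1 ^ \<gamma> *
          (const l * (?y1 ^ (c + s) * (?y2 ^ (\<delta> - s) * ?y2 ^ d))))"
      unfolding k_def[symmetric] l_def[symmetric]
      by (simp only: mult.assoc const_left_commute[of "?x1 ^ a"])
    also have "\<dots> = const (k * l) * (?x1 ^ a * ?x1 ^ (\<alpha> + r) * (?x2 ^ (b - r) * ?x2 ^ \<beta>) *
        (?y1 ^ \<gamma> * ?y1 ^ (c + s)) * (?y2 ^ (\<delta> - s) * ?y2 ^ d))"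
      unfolding const_merge by (simp only: mult.assoc)
    also have "\<dots> = const (k * l) * word_monomial (a + \<alpha> + r, b - r + \<beta>, \<gamma> + c + s, \<delta> - s + d)"
      by (simp only: power_add[symmetric] word_monomial_def prod.case add.assoc)
    finally show "?x1 ^ a * ?u r * (?x2 ^ \<beta> * ?y1 ^ \<gamma>) * ?v s * ?y2 ^ d =
        const (Lambda (q_of F) (r_of F) b \<alpha> r * Lambda (p_of F) (s_of F) \<delta> c s) *
        word_monomial (a + \<alpha> + r, b - r + \<beta>, \<gamma> + c + s, \<delta> - s + d)"
      by (simp only: k_def l_def)
  qed
  finally show ?thesis .
qed

text \<open>Expand the inner block of the product by \<open>Theta\<close>, straighten each resulting
  term, and read off the coordinate at \<open>M\<close>.\<close>

lemma mconst_eq_coord: "mconst F m m' M = coord (word_monomial m * word_monomial m') M"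
proof -
  let ?B = "B_relators F"
  obtain a b c d where m: "m = (a, b, c, d)" by (cases m)
  obtain a' b' c' d' where m': "m' = (a', b', c', d')" by (cases m')
  obtain A B C D where M: "M = (A, B, C, D)" by (cases M)
  let ?x1 = "gen (Lx i1)" and ?x2 = "gen (Lx i2)" and ?y1 = "gen (Ly i1)" and ?y2 = "gen (Ly i2)"
  define \<Theta> where "\<Theta> = Theta F (a', b', c, d)"
  define T where "T = {t. \<Theta> t \<noteq> 0}"
  have T: "finite T"
    unfolding T_def \<Theta>_def Theta_eq by (rule finite_coord)
  \<comment> \<open>The range of \<open>(r, s)\<close> where both \<open>Lambda\<close> factors can
    be nonzero; the last component of \<open>t\<close> is the exponent \<delta>.\<close>
  let ?S = "\<lambda>t. {..b} \<times> {..snd (snd (snd t))}"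
  define g where "g = (\<lambda>(\<alpha>, \<beta>, \<gamma>, \<delta>, r, s). \<Theta> (\<alpha>, \<beta>, \<gamma>, \<delta>) *
     Lambda (q_of F) (r_of F) b \<alpha> r * Lambda (p_of F) (s_of F) \<delta> c' s *
     of_bool (A = a + \<alpha> + r) * of_bool (int B = int b - int r + int \<beta>) *
     of_bool (C = \<gamma> + c' + s) * of_bool (int D = int \<delta> - int s + int d'))"
  define flat :: "exponents \<times> nat \<times> nat \<Rightarrow> nat \<times> nat \<times> nat \<times> nat \<times> nat \<times> nat"
    where "flat = (\<lambda>((\<alpha>, \<beta>, \<gamma>, \<delta>), (r, s)). (\<alpha>, \<beta>, \<gamma>, \<delta>, r, s))"
  have inj: "inj_on flat Z" for Z
    by (auto simp: inj_on_def flat_def)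
  have supp: "{i. g i \<noteq> 0} \<subseteq> flat ` Sigma T ?S"
  proof
    fix i assume i: "i \<in> {i. g i \<noteq> 0}"
    obtain \<alpha> \<beta> \<gamma> \<delta> r s where [simp]: "i = (\<alpha>, \<beta>, \<gamma>, \<delta>, r, s)" by (cases i)
    have "(\<alpha>, \<beta>, \<gamma>, \<delta>) \<in> T" "r \<le> b" "s \<le> \<delta>"
      using i by (auto simp: g_def T_def Lambda_def split: if_splits)
    then have "((\<alpha>, \<beta>, \<gamma>, \<delta>), (r, s)) \<in> Sigma T ?S" by simp
    moreover have "i = flat ((\<alpha>, \<beta>, \<gamma>, \<delta>), (r, s))" by (simp add: flat_def)
    ultimately show "i \<in> flat ` Sigma T ?S" by blast
  qed
  have "mconst F m m' M = Sum_any g"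
    by (simp add: mconst_def m m' M g_def \<Theta>_def)
  also have "\<dots> = sum g (flat ` Sigma T ?S)"
    using T supp by (intro Sum_any.expand_superset) auto
  also have "\<dots> = (\<Sum>t\<in>T. \<Sum>i\<in>?S t. g (flat (t, i)))"
    using T by (subst sum.Sigma) (auto simp: sum.reindex[OF inj])
  also have "\<dots> = (\<Sum>t\<in>T. \<Theta> t * coord (?x1 ^ a * ?x2 ^ b * word_monomial t * ?y1 ^ c' * ?y2 ^ d') M)"
  proof (intro sum.cong refl)
    fix t :: exponents
    obtain \<alpha> \<beta> \<gamma> \<delta> where t: "t = (\<alpha>, \<beta>, \<gamma>, \<delta>)" by (cases t)
    have "\<Theta> t * coord (?x1 ^ a * ?x2 ^ b * word_monomial t * ?y1 ^ c' * ?y2 ^ d') M =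
        (\<Sum>r\<le>b. \<Sum>s\<le>\<delta>. \<Theta> t * (Lambda (q_of F) (r_of F) b \<alpha> r * Lambda (p_of F) (s_of F) \<delta> c' s *
          of_bool (M = (a + \<alpha> + r, b - r + \<beta>, \<gamma> + c' + s, \<delta> - s + d'))))"
      unfolding t coord_cong[OF straighten_xy] coord_sum coord_smult coord_self sum_distrib_left ..
    also have "\<dots> = (\<Sum>r\<le>b. \<Sum>s\<le>\<delta>. g (flat (t, (r, s))))"
    proof (intro sum.cong refl)
      fix r s assume "r \<in> {..b}" "s \<in> {..\<delta>}"
      \<comment> \<open>Within these bounds natural and integer subtraction agree.\<close>
      then have "(M = (a + \<alpha> + r, b - r + \<beta>, \<gamma> + c' + s, \<delta> - s + d')) \<longleftrightarrow>
          A = a + \<alpha> + r \<and> int B = int b - int r + int \<beta> \<and> C = \<gamma> + c' + s \<and> int D = int \<delta> - int s + int d'"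
        by (auto simp: M)
      then show "\<Theta> t * (Lambda (q_of F) (r_of F) b \<alpha> r * Lambda (p_of F) (s_of F) \<delta> c' s *
          of_bool (M = (a + \<alpha> + r, b - r + \<beta>, \<gamma> + c' + s, \<delta> - s + d'))) = g (flat (t, (r, s)))"
        by (simp only: g_def flat_def t prod.case of_bool_conj mult.assoc)
    qed
    also have "\<dots> = (\<Sum>i\<in>?S t. g (flat (t, i)))"
      by (simp add: sum.cartesian_product t case_prod_unfold)
    finally show "(\<Sum>i\<in>?S t. g (flat (t, i))) =
        \<Theta> t * coord (?x1 ^ a * ?x2 ^ b * word_monomial t * ?y1 ^ c' * ?y2 ^ d') M" by simp
  qed
  also have "\<dots> = coord (\<Sum>t\<in>T. const (\<Theta> t) * (?x1 ^ a * ?x2 ^ b * word_monomial t * ?y1 ^ c' * ?y2 ^ d')) M"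
    by (simp only: coord_sum coord_smult)
  also have "(\<Sum>t\<in>T. const (\<Theta> t) * (?x1 ^ a * ?x2 ^ b * word_monomial t * ?y1 ^ c' * ?y2 ^ d')) =
      ?x1 ^ a * ?x2 ^ b * (\<Sum>t\<in>T. const (\<Theta> t) * word_monomial t) * ?y1 ^ c' * ?y2 ^ d'"
    by (simp only: sum_distrib_left sum_distrib_right mult.assoc const_left_commute[of "?x1 ^ a"]
        const_left_commute[of "?x2 ^ b"])
  \<comment> \<open>The sum over \<open>T\<close> is the normal form of the inner block, which is
    now folded back.\<close>
  also have "coord \<dots> = coord (?x1 ^ a * ?x2 ^ b * (?y1 ^ c * ?y2 ^ d * ?x1 ^ a' * ?x2 ^ b') * ?y1 ^ c' * ?y2 ^ d')"
    unfolding T_def \<Theta>_def Theta_eq by (intro coord_cong cls_mult cls_coord[symmetric] refl)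
  also have "?x1 ^ a * ?x2 ^ b * (?y1 ^ c * ?y2 ^ d * ?x1 ^ a' * ?x2 ^ b') * ?y1 ^ c' * ?y2 ^ d' =
      word_monomial m * word_monomial m'"
    by (simp only: m m' word_monomial_def prod.case mult.assoc)
  finally show ?thesis .
qed

section \<open>Right multiplication by a linear form\<close>

lemma coord_mult_linear:
  "coord (u * (const l1 * gen (Lx i1) + const l2 * gen (Lx i2) + const k1 * gen (Ly i1)
      + const k2 * gen (Ly i2))) M =
     l1 * Sum_any (\<lambda>m. coord u m * mconst F m (1, 0, 0, 0) M)
   + l2 * Sum_any (\<lambda>m. coord u m * mconst F m (0, 1, 0, 0) M)
   + k1 * Sum_any (\<lambda>m. coord u m * mconst F m (0, 0, 1, 0) M)
   + k2 * Sum_any (\<lambda>m. coord u m * mconst F m (0, 0, 0, 1) M)"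
proof -
  let ?S = "{m. coord u m \<noteq> 0}"
  have step: "coord (u * (const l * word_monomial m')) M =
      l * Sum_any (\<lambda>m. coord u m * mconst F m m' M)" for l m'
  proof -
    have "coord (u * (const l * word_monomial m')) =
        coord ((\<Sum>m\<in>?S. const (coord u m) * word_monomial m) * (const l * word_monomial m'))"
      by (intro coord_cong cls_mult cls_coord refl)
    also have "(\<Sum>m\<in>?S. const (coord u m) * word_monomial m) * (const l * word_monomial m') =
        const l * (\<Sum>m\<in>?S. const (coord u m) * (word_monomial m * word_monomial m'))"
      by (simp only: const_left_commute) (simp only: sum_distrib_right mult.assoc)
    finally have "coord (u * (const l * word_monomial m')) M = l * (\<Sum>m\<in>?S. coord u m * mconst F m m' M)"
      by (simp only: coord_smult coord_sum mconst_eq_coord)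
    also have "(\<Sum>m\<in>?S. coord u m * mconst F m m' M) = Sum_any (\<lambda>m. coord u m * mconst F m m' M)"
      by (rule Sum_any.expand_superset[symmetric]) (auto simp: finite_coord)
    finally show ?thesis .
  qed
  \<comment> \<open>Each generator is itself a basis monomial, so its right multiplication is given
    by product constants.\<close>
  have "gen (Lx i1) = (word_monomial (1, 0, 0, 0) :: (letter, 'k) free_alg)"
    "gen (Lx i2) = (word_monomial (0, 1, 0, 0) :: (letter, 'k) free_alg)"
    "gen (Ly i1) = (word_monomial (0, 0, 1, 0) :: (letter, 'k) free_alg)"
    "gen (Ly i2) = (word_monomial (0, 0, 0, 1) :: (letter, 'k) free_alg)"
    by (simp_all add: word_monomial_def)
  then show ?thesis
    by (simp only: distrib_left coord_add step)
qed

lemma coord_1: "coord 1 m = of_bool (m = (0, 0, 0, 0))"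
  using coord_self[of "(0, 0, 0, 0)" m] by (simp add: word_monomial_def)

lemma linear_form_power_coefficients:
  "\<exists>c. (\<forall>N e. is_expansion F (linear_form F l1 l2 k1 k2 [^]\<^bsub>B_alg F\<^esub> N) e \<longleftrightarrow> e = c N) \<and>
     (\<forall>m. c 0 m = of_bool (m = (0, 0, 0, 0))) \<and>
     (\<forall>N M. c (Suc N) M =
         l1 * Sum_any (\<lambda>m. c N m * mconst F m (1, 0, 0, 0) M)
       + l2 * Sum_any (\<lambda>m. c N m * mconst F m (0, 1, 0, 0) M)
       + k1 * Sum_any (\<lambda>m. c N m * mconst F m (0, 0, 1, 0) M)
       + k2 * Sum_any (\<lambda>m. c N m * mconst F m (0, 0, 0, 1) M))"
proof -
  define L where "L = const l1 * gen (Lx i1) + const l2 * gen (Lx i2) + const k1 * gen (Ly i1)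
      + const k2 * gen (Ly i2)"
  have "linear_form F l1 l2 k1 k2 [^]\<^bsub>B_alg F\<^esub> N = cls (B_relators F) (L ^ N)" for N :: nat
    by (simp add: linear_form_def L_def B_alg_def xB_def yB_def presented_alg_simps presented_alg_pow)
  then have "is_expansion F (linear_form F l1 l2 k1 k2 [^]\<^bsub>B_alg F\<^esub> N) e \<longleftrightarrow> e = coord (L ^ N)" for N e
    by (simp only: is_expansion_iff_coord)
  moreover have "coord (L ^ 0) m = of_bool (m = (0, 0, 0, 0))" for m
    by (simp add: coord_1)
  \<comment> \<open>The new factor must be split off on the right to match the order of arguments in
    \<open>mconst\<close>.\<close>
  moreover have "coord (L ^ Suc N) M = coord (L ^ N * L) M" for N M
    by (simp only: power_Suc2)
  ultimately show ?thesis
    unfolding L_def coord_mult_linear by (intro exI[of _ "\<lambda>N. coord (L ^ N)"]) (simp add: L_def)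
qed

end

theorem proposition3p12:
  fixes F :: "'k::{alg_closed_field, field_char_0} family"
    and lam1 lam2 mu1 mu2 :: 'k
  assumes "admissible F"
  shows "(\<forall>N::nat. \<exists>!e. is_expansion F (linear_form F lam1 lam2 mu1 mu2 [^]\<^bsub>B_alg F\<^esub> N) e) \<and>
    (\<forall>E :: nat \<Rightarrow> exponents \<Rightarrow> 'k.
      (\<forall>N. is_expansion F (linear_form F lam1 lam2 mu1 mu2 [^]\<^bsub>B_alg F\<^esub> N) (E N)) \<longleftrightarrow>
      E 0 (0, 0, 0, 0) = 1 \<and>
      (\<forall>A B C D. (A, B, C, D) \<noteq> (0, 0, 0, 0) \<longrightarrow> E 0 (A, B, C, D) = 0) \<and>
      (\<forall>N A B C D. E (N + 1) (A, B, C, D) =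
          lam1 * Sum_any (\<lambda>(A', B', C', D'). E N (A', B', C', D') *
                 mconst F (A', B', C', D') (1, 0, 0, 0) (A, B, C, D))
        + lam2 * Sum_any (\<lambda>(A', B', C', D'). E N (A', B', C', D') *
                 mconst F (A', B', C', D') (0, 1, 0, 0) (A, B, C, D))
        + mu1 * Sum_any (\<lambda>(A', B', C', D'). E N (A', B', C', D') *
                 mconst F (A', B', C', D') (0, 0, 1, 0) (A, B, C, D))
        + mu2 * Sum_any (\<lambda>(A', B', C', D'). E N (A', B', C', D') *
                 mconst F (A', B', C', D') (0, 0, 0, 1) (A, B, C, D))))"
proof -
  define rhs :: "(exponents \<Rightarrow> 'k) \<Rightarrow> exponents \<Rightarrow> 'k" where "rhs e M =
         lam1 * Sum_any (\<lambda>m. e m * mconst F m (1, 0, 0, 0) M)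
       + lam2 * Sum_any (\<lambda>m. e m * mconst F m (0, 1, 0, 0) M)
       + mu1 * Sum_any (\<lambda>m. e m * mconst F m (0, 0, 1, 0) M)
       + mu2 * Sum_any (\<lambda>m. e m * mconst F m (0, 0, 0, 1) M)" for e M
  obtain c where c: "\<And>N e. is_expansion F (linear_form F lam1 lam2 mu1 mu2 [^]\<^bsub>B_alg F\<^esub> N) e \<longleftrightarrow> e = c N"
      "\<And>m. c 0 m = of_bool (m = (0, 0, 0, 0))" "\<And>N. c (Suc N) = rhs (c N)"
    using linear_form_power_coefficients[OF assms, of lam1 lam2 mu1 mu2]
    unfolding rhs_def fun_eq_iff by blast
  have curry: "(\<lambda>(A', B', C', D'). e (A', B', C', D') * mconst F (A', B', C', D') i M) =
      (\<lambda>m. e m * mconst F m i M)" for e :: "exponents \<Rightarrow> 'k" and i M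
    by (simp add: fun_eq_iff)
  \<comment> \<open>The recurrence determines each stage from the previous one, so induction on
    \<open>N\<close> identifies any solution with \<open>c\<close>; in particular its finite support
    is a consequence.\<close>
  have "(\<forall>N. E N = c N) \<longleftrightarrow> E 0 (0, 0, 0, 0) = 1 \<and>
      (\<forall>A B C D. (A, B, C, D) \<noteq> (0, 0, 0, 0) \<longrightarrow> E 0 (A, B, C, D) = 0) \<and>
      (\<forall>N A B C D. E (N + 1) (A, B, C, D) = rhs (E N) (A, B, C, D))" (is "?l \<longleftrightarrow> ?r") for E
  proof
    assume ?l
    then show ?r by (simp add: c)
  next
    assume r: ?r
    have "E N = c N" for N
    proof (induction N)
      case 0
      show ?case using r by (auto simp: fun_eq_iff c(2))
    next
      case (Suc N)
      show ?case using r by (simp add: fun_eq_iff c(3) flip: Suc.IH)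
    qed
    then show ?l ..
  qed
  then show ?thesis
    unfolding c(1) curry rhs_def by blast
qed

end
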